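(* Let $\mathcal S=(S_1,\dots,S_N)$ be a global solution of $$\dot S_i = S_i\Xi_i+\frac{\kappa}{N}\sum_{k=1}^N a_{ik}\Big[S_k-\tfrac12\big(S_iS_i^\top S_k+S_iS_k^\top S_i\big)\Big],\qquad S_i(0)=S_i^{\mathrm{in}}\in \mathrm{St}(p,n),\quad i=1,\dots,N.$$ Suppose that $$\kappa>\max\left\{\frac{\sqrt{6p}}{9}\,\frac{\|\Xi\|_\infty}{a_m},\ \frac{16p^2a_M^3\|\Xi\|_\infty}{a_m(8pa_M^2\Lambda-\Lambda^3)}\right\},\qquad \max_{1\le i,j\le N}\|S_i^{\mathrm{in}}-S_j^{\mathrm{in}}\|_F<\beta .$$ Then $\mathcal S$ tends to a phase-locked state: the limit $\lim_{t\to\infty}S_i(t)^\top S_j(t)$ exists for all $i,j=1,\dots,N$.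
   Context: $1\le p\le n$ and $N\ge 1$ are integers. $\mathrm{St}(p,n)=\{S\in\mathbb R^{n\times p}: S^\top S=I_p\}$; $\|\cdot\|_F$ is the Frobenius norm. $\Xi_i\in\mathfrak{so}(p)$ are real skew-symmetric $p\times p$ matrices, $\|\Xi\|_\infty:=\max_i\|\Xi_i\|_F$ (heterogeneous ensemble, so $\|\Xi\|_\infty>0$), $\kappa>0$. The weights satisfy $a_{ik}=a_{ki}>0$. Set $a_m:=\min_{i,k}a_{ik}$, $a_M:=\max_{i,k}a_{ik}$, $d(\mathcal A):=\max_{i,j,k}|a_{ik}-a_{jk}|$, and $$\Lambda:=a_m-\frac{N-1}{N}\big(a_M+d(\mathcal A)\big),$$ and assume $0<\Lambda<8pa_M^2$. Let $$\kappa_*:=\frac{16p^2a_M^3\|\Xi\|_\infty}{a_m(8pa_M^2\Lambda-\Lambda^3)},$$ and let $0<\alpha<\beta$ be the two positive roots of $r^3-2r+\dfrac{2\sqrt p\,\|\Xi\|_\infty}{\kappa_*a_m}=0$. A global solution is a solution existing for all $t\ge0$ (with $S_i(t)\in\mathrm{St}(p,n)$). *)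

theory Defs
  imports "HOL-Analysis.Analysis"
begin

text \<open>
  An \<open>n \<times> p\<close> real matrix has type \<open>real ^ 'p ^ 'n\<close>, with \<open>p = CARD('p)\<close> and \<open>n = CARD('n)\<close>.
  The norm of this type is the Frobenius norm:
\<close>

lemma norm_eq_frobenius:
  fixes A :: "real ^ 'p ^ 'n"
  shows "norm A = sqrt (\<Sum>i\<in>UNIV. \<Sum>j\<in>UNIV. (A $ i $ j)\<^sup>2)"
  by (simp add: norm_vec_def L2_set_def sum_nonneg)

definition stiefel :: "(real ^ 'p ^ 'n) set" where
  "stiefel = {S. transpose S ** S = mat 1}"

definition skew_symmetric :: "real ^ 'p ^ 'p \<Rightarrow> bool" where
  "skew_symmetric X \<longleftrightarrow> transpose X = - X"

text \<open>The oscillators are indexed by \<open>{1..N}\<close>; values of families at other indices are irrelevant.\<close>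

definition Xi_norm :: "nat \<Rightarrow> (nat \<Rightarrow> real ^ 'p ^ 'p) \<Rightarrow> real" where
  "Xi_norm N \<Xi> = (MAX i\<in>{1..N}. norm (\<Xi> i))"

definition a_min :: "nat \<Rightarrow> (nat \<Rightarrow> nat \<Rightarrow> real) \<Rightarrow> real" where
  "a_min N a = (MIN (i, k)\<in>{1..N} \<times> {1..N}. a i k)"

definition a_max :: "nat \<Rightarrow> (nat \<Rightarrow> nat \<Rightarrow> real) \<Rightarrow> real" where
  "a_max N a = (MAX (i, k)\<in>{1..N} \<times> {1..N}. a i k)"

definition a_diam :: "nat \<Rightarrow> (nat \<Rightarrow> nat \<Rightarrow> real) \<Rightarrow> real" where
  "a_diam N a = (MAX (i, j, k)\<in>{1..N} \<times> {1..N} \<times> {1..N}. \<bar>a i k - a j k\<bar>)"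

definition Lam :: "nat \<Rightarrow> (nat \<Rightarrow> nat \<Rightarrow> real) \<Rightarrow> real" where
  "Lam N a = a_min N a - (real N - 1) / real N * (a_max N a + a_diam N a)"

definition kappa_star :: "nat \<Rightarrow> (nat \<Rightarrow> nat \<Rightarrow> real) \<Rightarrow> (nat \<Rightarrow> real ^ 'p ^ 'p) \<Rightarrow> real" where
  "kappa_star N a \<Xi> =
     16 * (real CARD('p))\<^sup>2 * a_max N a ^ 3 * Xi_norm N \<Xi> /
     (a_min N a * (8 * real CARD('p) * (a_max N a)\<^sup>2 * Lam N a - Lam N a ^ 3))"

definition lohe_field ::
  "nat \<Rightarrow> real \<Rightarrow> (nat \<Rightarrow> nat \<Rightarrow> real) \<Rightarrow> (nat \<Rightarrow> real ^ 'p ^ 'p) \<Rightarrow>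
   (nat \<Rightarrow> real ^ 'p ^ 'n) \<Rightarrow> nat \<Rightarrow> real ^ 'p ^ 'n" where
  "lohe_field N \<kappa> a \<Xi> S i =
     S i ** \<Xi> i + (\<kappa> / real N) *\<^sub>R (\<Sum>k = 1..N. a i k *\<^sub>R
       (S k - (1 / 2) *\<^sub>R (S i ** transpose (S i) ** S k + S i ** transpose (S k) ** S i)))"

text \<open>At \<open>t = 0\<close> the derivative is the right-hand one.\<close>

definition global_solution ::
  "nat \<Rightarrow> real \<Rightarrow> (nat \<Rightarrow> nat \<Rightarrow> real) \<Rightarrow> (nat \<Rightarrow> real ^ 'p ^ 'p) \<Rightarrow>
   (nat \<Rightarrow> real ^ 'p ^ 'n) \<Rightarrow> (nat \<Rightarrow> real \<Rightarrow> real ^ 'p ^ 'n) \<Rightarrow> bool" where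
  "global_solution N \<kappa> a \<Xi> Sin S \<longleftrightarrow>
     (\<forall>i\<in>{1..N}. S i 0 = Sin i \<and>
       (\<forall>t\<ge>0. S i t \<in> stiefel \<and>
         (S i has_vector_derivative lohe_field N \<kappa> a \<Xi> (\<lambda>k. S k t) i) (at t within {0..})))"

definition phase_locks :: "nat \<Rightarrow> (nat \<Rightarrow> real \<Rightarrow> real ^ 'p ^ 'n) \<Rightarrow> bool" where
  "phase_locks N S \<longleftrightarrow>
     (\<forall>i\<in>{1..N}. \<forall>j\<in>{1..N}. \<exists>L. ((\<lambda>t. transpose (S i t) ** S j t) \<longlongrightarrow> L) at_top)"

end

theory Submission
  imports Defs
begin

text \<open>
  Write \<open>A\<^sub>i\<^sub>j = S\<^sub>i\<^sup>T S\<^sub>j\<close> and \<open>U\<^sub>i\<^sub>k = (S\<^sub>i - S\<^sub>k)\<^sup>T (S\<^sub>i - S\<^sub>k) / 2\<close>.  On the Stiefel manifold the coupling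
  \<open>S\<^sub>k - (S\<^sub>i S\<^sub>i\<^sup>T S\<^sub>k + S\<^sub>i S\<^sub>k\<^sup>T S\<^sub>i) / 2\<close> equals \<open>S\<^sub>k - S\<^sub>i + S\<^sub>i U\<^sub>i\<^sub>k\<close>, and the matrices \<open>A\<^sub>i\<^sub>j\<close> satisfy a closed
  system.  The proof shows that all solutions of small spread forget their initial Gram matrices
  exponentially fast, and that every solution considered here reaches a small spread.

  Attraction.  Let \<open>d\<close> be the largest distance \<open>\<parallel>S\<^sub>i - S\<^sub>j\<parallel>\<close>.  As long as \<open>d\<^sup>2 \<le> 2\<close>, a farthest pair
  approaches with \<open>d' \<le> 2 \<parallel>\<Xi>\<parallel> - \<kappa> a\<^sub>m (d - (N - 1) d\<^sup>3 / (2 N))\<close> (\<open>farthest_pair_rate\<close>).  Put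
  \<open>l = \<Lambda> / a\<^sub>M\<close>; then \<open>l \<le> 1 / N\<close> for \<open>N \<ge> 2\<close>, and for \<open>N = 1\<close> there is
  nothing to show.  The lower bound on \<open>\<kappa>\<close> gives \<open>2 \<parallel>\<Xi>\<parallel> < \<kappa> a\<^sub>m l / p\<close>, where \<open>p \<ge> 2\<close> because
  some \<open>\<Xi>\<^sub>i\<close> is a nonzero skew-symmetric matrix, while the cubic is at least \<open>l / 2\<close> for
  \<open>3 l / 4 \<le> d \<le> \<surd>2\<close> (\<open>cubic_gap\<close>).  Since \<open>\<beta>\<close> is a root of \<open>r\<^sup>3 - 2 r + c\<close> with \<open>c > 0\<close>, it is below
  \<open>\<surd>2\<close>.  Hence the spread eventually drops below \<open>4 l / 5\<close> (\<open>spread_eventually_le\<close>).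

  Contraction.  For two solutions of spread at most \<open>D\<close> let \<open>E\<^sub>i\<^sub>j\<close> be the difference of their \<open>A\<^sub>i\<^sub>j\<close>.
  The rotations do not change \<open>\<parallel>E\<^sub>i\<^sub>j\<parallel>\<close>, and the largest of these norms obeys
  \<open>e' \<le> - 2 \<kappa> (\<Lambda> - a\<^sub>M (D + D\<^sup>2 / 2)) e\<close> (\<open>gram_distance_rate\<close>).  For \<open>D = 4 l / 5\<close> the bracket is
  positive.  Applied to a solution and to its own time shifts, this makes every \<open>A\<^sub>i\<^sub>j\<close> a Cauchy
  function of time, so it converges.

  Both maxima are controlled by the same comparison principle, \<open>finite_family_below_barrier\<close>.
\<close>

section \<open>The Frobenius inner product\<close>

lemma inner_eq_trace:
  fixes A B :: "real ^ 'p ^ 'n"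
  shows "A \<bullet> B = trace (transpose A ** B)"
  unfolding inner_vec_def trace_def matrix_matrix_mult_def transpose_def
  by (simp add: sum.swap[of _ "UNIV :: 'n set"])

lemma inner_transpose:
  fixes A B :: "real ^ 'p ^ 'n"
  shows "transpose A \<bullet> transpose B = A \<bullet> B"
  unfolding inner_vec_def transpose_def
  by (simp add: sum.swap[of _ "UNIV :: 'n set"])

lemma inner_matrix_mult_left:
  fixes A :: "real ^ 'k ^ 'n" and B :: "real ^ 'p ^ 'k"
  shows "(A ** B) \<bullet> C = B \<bullet> (transpose A ** C)"
  by (simp add: inner_eq_trace matrix_transpose_mul matrix_mul_assoc)

lemma norm_transpose:
  fixes A :: "real ^ 'p ^ 'n"
  shows "norm (transpose A) = norm A"
  by (simp add: norm_eq_sqrt_inner inner_transpose)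

lemma norm_matrix_mult_le:
  fixes A :: "real ^ 'k ^ 'n" and B :: "real ^ 'p ^ 'k"
  shows "norm (A ** B) \<le> norm A * norm B"
proof -
  have entry: "((A ** B) $ i $ j)\<^sup>2 \<le> (norm (A $ i))\<^sup>2 * (norm (transpose B $ j))\<^sup>2" for i j
  proof -
    have "(A ** B) $ i $ j = A $ i \<bullet> transpose B $ j"
      by (simp add: matrix_matrix_mult_def inner_vec_def transpose_def)
    then show ?thesis
      using Cauchy_Schwarz_ineq[of "A $ i" "transpose B $ j"]
      by (simp add: power2_norm_eq_inner)
  qed
  have sq: "(norm X)\<^sup>2 = (\<Sum>i\<in>UNIV. (norm (X $ i))\<^sup>2)" for X :: "real ^ 'r ^ 's"
    by (simp add: norm_vec_def L2_set_def sum_nonneg)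
  have "(norm (A ** B))\<^sup>2 = (\<Sum>i\<in>UNIV. \<Sum>j\<in>UNIV. ((A ** B) $ i $ j)\<^sup>2)"
    by (simp add: norm_eq_frobenius sum_nonneg)
  also have "\<dots> \<le> (\<Sum>i\<in>UNIV. \<Sum>j\<in>UNIV. (norm (A $ i))\<^sup>2 * (norm (transpose B $ j))\<^sup>2)"
    by (intro sum_mono entry)
  also have "\<dots> = (norm A)\<^sup>2 * (norm (transpose B))\<^sup>2"
    by (simp add: sq sum_product)
  finally have "(norm (A ** B))\<^sup>2 \<le> (norm A * norm B)\<^sup>2"
    by (simp add: norm_transpose power_mult_distrib)
  then show ?thesis
    by (rule power2_le_imp_le) simp
qed

lemma bounded_bilinear_matrix_mult:
  "bounded_bilinear (\<lambda>(A :: real ^ 'k ^ 'n) (B :: real ^ 'p ^ 'k). A ** B)"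
proof
  fix A A' :: "real ^ 'k ^ 'n" and B B' :: "real ^ 'p ^ 'k" and r :: real
  show "(A + A') ** B = A ** B + A' ** B"
    by (simp add: vec_eq_iff matrix_matrix_mult_def sum.distrib distrib_right)
  show "A ** (B + B') = A ** B + A ** B'"
    by (rule matrix_add_ldistrib)
  show "(r *\<^sub>R A) ** B = r *\<^sub>R (A ** B)"
    by (simp add: vec_eq_iff matrix_matrix_mult_def sum_distrib_left mult.assoc)
  show "A ** (r *\<^sub>R B) = r *\<^sub>R (A ** B)"
    by (simp add: vec_eq_iff matrix_matrix_mult_def sum_distrib_left mult.left_commute)
  show "\<exists>K. \<forall>(A :: real ^ 'k ^ 'n) (B :: real ^ 'p ^ 'k). norm (A ** B) \<le> norm A * norm B * K"
    using norm_matrix_mult_le by (metis mult.right_neutral)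
qed

lemma bounded_linear_transpose:
  "bounded_linear (transpose :: real ^ 'p ^ 'n \<Rightarrow> real ^ 'n ^ 'p)"
proof (rule bounded_linear_intro[where K = 1])
  fix A :: "real ^ 'p ^ 'n"
  show "norm (transpose A) \<le> norm A * 1"
    by (simp add: norm_transpose)
qed (simp_all add: vec_eq_iff transpose_def)

lemmas matrix_bilinear_simps =
  bounded_bilinear.add_left[OF bounded_bilinear_matrix_mult]
  bounded_bilinear.add_right[OF bounded_bilinear_matrix_mult]
  bounded_bilinear.diff_left[OF bounded_bilinear_matrix_mult]
  bounded_bilinear.diff_right[OF bounded_bilinear_matrix_mult]
  bounded_bilinear.minus_left[OF bounded_bilinear_matrix_mult]
  bounded_bilinear.minus_right[OF bounded_bilinear_matrix_mult]
  bounded_bilinear.scaleR_left[OF bounded_bilinear_matrix_mult]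
  bounded_bilinear.scaleR_right[OF bounded_bilinear_matrix_mult]
  bounded_bilinear.sum_left[OF bounded_bilinear_matrix_mult]
  bounded_bilinear.sum_right[OF bounded_bilinear_matrix_mult]

lemmas transpose_linear_simps =
  linear_add[OF bounded_linear.linear[OF bounded_linear_transpose]]
  linear_diff[OF bounded_linear.linear[OF bounded_linear_transpose]]
  linear_neg[OF bounded_linear.linear[OF bounded_linear_transpose]]
  linear_cmul[OF bounded_linear.linear[OF bounded_linear_transpose]]
  linear_sum[OF bounded_linear.linear[OF bounded_linear_transpose]]

lemma inner_skew_symmetric_mult:
  fixes X :: "real ^ 'p ^ 'p"
  assumes "skew_symmetric X"
  shows "E \<bullet> (X ** E) = 0"
proof -
  have "(X ** E) \<bullet> E = E \<bullet> (- (X ** E))"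
    using assms by (simp add: inner_matrix_mult_left skew_symmetric_def matrix_bilinear_simps)
  then show ?thesis
    by (simp add: inner_commute)
qed

lemma inner_skew_symmetric_one:
  assumes "skew_symmetric X"
  shows "X \<bullet> mat 1 = 0"
  using inner_skew_symmetric_mult[OF assms, of "mat 1"] by (simp add: inner_commute)

section \<open>Stiefel matrices\<close>

lemma norm_stiefel_mult:
  fixes Q :: "real ^ 'p ^ 'n"
  assumes "Q \<in> stiefel"
  shows "norm (Q ** Y) = norm Y"
proof -
  have "(Q ** Y) \<bullet> (Q ** Y) = Y \<bullet> Y"
    using assms by (simp add: inner_matrix_mult_left matrix_mul_assoc stiefel_def)
  then show ?thesis
    by (simp add: norm_eq_sqrt_inner)
qed

lemma norm_transpose_stiefel_mult_le:
  fixes Q :: "real ^ 'p ^ 'n"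
  assumes "Q \<in> stiefel"
  shows "norm (transpose Q ** X) \<le> norm X"
proof -
  let ?Y = "transpose Q ** X"
  have "(norm ?Y)\<^sup>2 = (Q ** ?Y) \<bullet> X"
    by (simp add: power2_norm_eq_inner inner_matrix_mult_left)
  also have "\<dots> \<le> norm ?Y * norm X"
    using norm_cauchy_schwarz[of "Q ** ?Y" X] by (simp add: norm_stiefel_mult[OF assms])
  finally show ?thesis
    by (metis (no_types, opaque_lifting) norm_ge_zero mult_le_cancel_left_pos norm_le_zero_iff
        order_le_less power2_eq_square linorder_not_less)
qed

text \<open>
  \<open>Q\<^sup>T R\<close> deviates from the identity by no more than \<open>R\<close> deviates from \<open>Q\<close>, because
  \<open>Q\<^sup>T R - I = Q\<^sup>T (R - Q)\<close> and \<open>Q\<^sup>T\<close> is a contraction.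
\<close>

lemma norm_gram_minus_one_le:
  fixes Q R :: "real ^ 'p ^ 'n"
  assumes "Q \<in> stiefel"
  shows "norm (transpose Q ** R - mat 1) \<le> norm (Q - R)"
proof -
  have "transpose Q ** R - mat 1 = transpose Q ** (R - Q)"
    using assms by (simp add: matrix_bilinear_simps stiefel_def)
  then show ?thesis
    using norm_transpose_stiefel_mult_le[OF assms, of "R - Q"] by (simp add: norm_minus_commute)
qed

text \<open>
  For \<open>X = Q - R\<close> with \<open>Q\<close>, \<open>R\<close> on the Stiefel manifold this is the defect from the identity of the
  symmetric part of \<open>Q\<^sup>T R\<close>.  It is of second order in \<open>X\<close>, which is why only skew parts matter to
  first order.
\<close>

definition half_gram :: "real ^ 'p ^ 'n \<Rightarrow> real ^ 'p ^ 'p" where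
  "half_gram X = (1 / 2) *\<^sub>R (transpose X ** X)"

lemma transpose_half_gram: "transpose (half_gram X) = half_gram X"
  by (simp add: half_gram_def transpose_linear_simps matrix_transpose_mul)

lemma norm_half_gram_le: "norm (half_gram X) \<le> (norm X)\<^sup>2 / 2"
  using norm_matrix_mult_le[of "transpose X" X]
  by (simp add: half_gram_def norm_transpose power2_eq_square)

lemma half_gram_inner_one: "half_gram X \<bullet> mat 1 = (norm X)\<^sup>2 / 2"
  by (simp add: half_gram_def inner_matrix_mult_left power2_norm_eq_inner)

lemma half_gram_stiefel:
  fixes Q R :: "real ^ 'p ^ 'n"
  assumes "Q \<in> stiefel" "R \<in> stiefel"
  shows "half_gram (Q - R) = mat 1 - (1 / 2) *\<^sub>R (transpose Q ** R + transpose R ** Q)"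
proof -
  have "transpose (Q - R) ** (Q - R) = mat 1 + mat 1 - (transpose Q ** R + transpose R ** Q)"
    using assms by (simp add: matrix_bilinear_simps transpose_linear_simps stiefel_def)
  then show ?thesis
    by (simp add: half_gram_def scaleR_diff_right flip: scaleR_2)
qed

lemma inner_stiefel:
  fixes Q R :: "real ^ 'p ^ 'n"
  assumes "Q \<in> stiefel" "R \<in> stiefel"
  shows "Q \<bullet> R = real CARD('p) - (norm (Q - R))\<^sup>2 / 2"
proof -
  have one: "T \<bullet> T = real CARD('p)" if "T \<in> stiefel" for T :: "real ^ 'p ^ 'n"
    using that by (simp add: inner_eq_trace stiefel_def trace_I)
  show ?thesis
    using one[OF assms(1)] one[OF assms(2)]
    by (simp add: power2_norm_eq_inner inner_diff_left inner_diff_right inner_commute field_simps)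
qed

lemma norm_stiefel:
  assumes "(Q :: real ^ 'p ^ 'n) \<in> stiefel"
  shows "norm Q = sqrt (real CARD('p))"
  using assms by (simp add: norm_eq_sqrt_inner inner_eq_trace stiefel_def trace_I)

section \<open>Barriers\<close>

text \<open>
  The maximum of finitely many smooth functions need not be differentiable, so a bound on it is
  propagated by comparison instead: at the first time when some member meets the barrier, that member
  is a maximal one and arrives from below, so its derivative cannot be smaller than that of the
  barrier.  Hence the derivative has to be estimated only for maximal members lying on the barrier.
\<close>

lemma finite_family_below_barrier:
  fixes f f' :: "'i \<Rightarrow> real \<Rightarrow> real" and h h' :: "real \<Rightarrow> real"
  assumes fin: "finite P"
    and start: "\<And>p. p \<in> P \<Longrightarrow> f p 0 < h 0"
    and df: "\<And>p t. p \<in> P \<Longrightarrow> 0 \<le> t \<Longrightarrow> (f p has_real_derivative f' p t) (at t within {0..})"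
    and dh: "\<And>t. 0 \<le> t \<Longrightarrow> (h has_real_derivative h' t) (at t within {0..})"
    and touch: "\<And>p t. \<lbrakk>p \<in> P; 0 < t; f p t = h t; \<And>q. q \<in> P \<Longrightarrow> f q t \<le> h t\<rbrakk> \<Longrightarrow> f' p t < h' t"
    and p: "p \<in> P" and t: "0 \<le> t"
  shows "f p t < h t"
proof (rule ccontr)
  assume "\<not> f p t < h t"
  have cont: "continuous_on {0..} (\<lambda>s. f q s - h s)" if "q \<in> P" for q
    by (intro continuous_on_diff)
       (use df[OF that] dh in \<open>auto simp: continuous_on_eq_continuous_within
          intro: has_field_derivative_imp_has_derivative has_derivative_continuous
            has_field_derivative_def[THEN iffD1]\<close>)
  define B where "B = (\<Union>q\<in>P. {s \<in> {0..}. 0 \<le> f q s - h s})"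
  have "closed {s \<in> {0..}. 0 \<le> f q s - h s}" if "q \<in> P" for q
    using continuous_on_closed_Collect_le[OF continuous_on_const cont[OF that], of 0]
    by simp
  then have "closed B"
    unfolding B_def using fin by blast
  have "t \<in> B"
    using \<open>\<not> f p t < h t\<close> p t by (force simp: B_def)
  have low: "bdd_below B"
    by (auto simp: B_def bdd_below_def)
  define \<tau> where "\<tau> = Inf B"
  have "\<tau> \<in> B"
    unfolding \<tau>_def using closed_contains_Inf[OF _ low \<open>closed B\<close>] \<open>t \<in> B\<close> by blast
  then obtain q where q: "q \<in> P" "0 \<le> \<tau>" "h \<tau> \<le> f q \<tau>"
    by (auto simp: B_def)
  have "0 < \<tau>"
    using q start[OF q(1)] by (cases "\<tau> = 0") auto
  \<comment> \<open>the infimum of the bad times is the first time of contact\<close>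
  have before: "f r s < h s" if "r \<in> P" "0 \<le> s" "s < \<tau>" for r s
  proof (rule ccontr)
    assume "\<not> f r s < h s"
    then have "s \<in> B"
      using that by (force simp: B_def)
    then show False
      using cInf_lower[OF _ low] that(3) by (force simp: \<tau>_def)
  qed
  have le: "f r \<tau> \<le> h \<tau>" if r: "r \<in> P" for r
  proof (rule ccontr)
    assume "\<not> f r \<tau> \<le> h \<tau>"
    then obtain s where "0 \<le> s" "s \<le> \<tau>" "f r s - h s = 0"
      using IVT'[of "\<lambda>s. f r s - h s" 0 0 \<tau>] start[OF r] \<open>0 < \<tau>\<close>
        continuous_on_subset[OF cont[OF r], of "{0..\<tau>}"] by auto
    with before[OF r, of s] \<open>\<not> f r \<tau> \<le> h \<tau>\<close> show False
      by (cases "s = \<tau>") auto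
  qed
  have eq: "f q \<tau> = h \<tau>"
    using le[OF q(1)] q(3) by simp
  have "((\<lambda>s. f q s - h s) has_real_derivative f' q \<tau> - h' \<tau>) (at \<tau> within {0..})"
    using df[OF q(1,2)] dh[OF q(2)] by (rule DERIV_diff)
  moreover have "f' q \<tau> - h' \<tau> < 0"
    using touch[OF q(1) \<open>0 < \<tau>\<close> eq le] by simp
  ultimately obtain e where e: "e > 0"
    "\<And>u. 0 < u \<Longrightarrow> \<tau> - u \<in> {0..} \<Longrightarrow> u < e \<Longrightarrow> f q \<tau> - h \<tau> < f q (\<tau> - u) - h (\<tau> - u)"
    using has_real_derivative_neg_dec_left by blast
  define u where "u = min (e / 2) \<tau>"
  have "0 < u" "u < e" "\<tau> - u \<ge> 0" "\<tau> - u < \<tau>"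
    using \<open>e > 0\<close> \<open>0 < \<tau>\<close> by (auto simp: u_def min_def)
  then show False
    using e(2)[of u] before[OF q(1), of "\<tau> - u"] eq by simp
qed

section \<open>The spread\<close>

text \<open>
  On the Stiefel manifold the coupling is plain attraction \<open>S\<^sub>k - S\<^sub>i\<close> plus a correction of second
  order.  All later estimates start from this form.
\<close>

lemma lohe_field_stiefel:
  assumes "\<And>k. k \<in> {1..N} \<Longrightarrow> S k \<in> stiefel" and "i \<in> {1..N}"
  shows "lohe_field N \<kappa> a \<Xi> S i = S i ** \<Xi> i + (\<kappa> / real N) *\<^sub>R
    (\<Sum>k = 1..N. a i k *\<^sub>R (S k - S i + S i ** half_gram (S i - S k)))"
proof -
  have "S k - (1 / 2) *\<^sub>R (S i ** transpose (S i) ** S k + S i ** transpose (S k) ** S i)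
      = S k - S i + S i ** half_gram (S i - S k)" if "k \<in> {1..N}" for k
    using assms that
    by (simp add: half_gram_stiefel matrix_bilinear_simps matrix_mul_assoc)
  then show ?thesis
    unfolding lohe_field_def by (simp only: cong: sum.cong)
qed

text \<open>
  Both contributions to the drift of \<open>S\<^sub>i\<close> are tested against \<open>S\<^sub>j\<close>.  The rotation only sees
  \<open>S\<^sub>i\<^sup>T S\<^sub>j - I\<close>, since a skew-symmetric matrix is orthogonal to the identity.  With
  \<open>U = half_gram (S\<^sub>i - S\<^sub>k)\<close> and \<open>V = half_gram (S\<^sub>i - S\<^sub>j)\<close>, the attraction towards \<open>S\<^sub>k\<close> contributes
  \<open>(S\<^sub>k - S\<^sub>i) \<bullet> S\<^sub>j + U \<bullet> I - U \<bullet> V\<close>.  For a farthest pair with \<open>d\<^sup>2 \<le> 2\<close> its lower bound is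
  nonnegative, and this is what allows every weight to be replaced by the smallest one.
\<close>

lemma inner_lohe_field_ge:
  fixes S :: "nat \<Rightarrow> real ^ 'p ^ 'n"
  assumes St: "\<And>k. k \<in> {1..N} \<Longrightarrow> S k \<in> stiefel"
    and i: "i \<in> {1..N}" and j: "j \<in> {1..N}"
    and skew: "skew_symmetric (\<Xi> i)" and x: "norm (\<Xi> i) \<le> x"
    and "0 \<le> \<kappa>" "0 \<le> m" and m: "\<And>k. k \<in> {1..N} \<Longrightarrow> m \<le> a i k"
    and d: "d = norm (S i - S j)" and "d\<^sup>2 \<le> 2"
    and max: "\<And>k l. k \<in> {1..N} \<Longrightarrow> l \<in> {1..N} \<Longrightarrow> norm (S k - S l) \<le> d"
  shows "\<kappa> / real N * (\<Sum>k = 1..N. m * ((d\<^sup>2 - (norm (S j - S k))\<^sup>2) / 2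
            + (norm (S i - S k))\<^sup>2 / 2 * (1 - d\<^sup>2 / 2))) - x * d
      \<le> lohe_field N \<kappa> a \<Xi> S i \<bullet> S j"
proof -
  let ?A = "transpose (S i) ** S j"
  have "norm (?A - mat 1) \<le> d"
    using norm_gram_minus_one_le[OF St[OF i], of "S j"] by (simp add: d)
  moreover have "(S i ** \<Xi> i) \<bullet> S j = \<Xi> i \<bullet> (?A - mat 1)"
    by (simp add: inner_matrix_mult_left inner_diff_right inner_skew_symmetric_one[OF skew])
  moreover have "\<bar>\<Xi> i \<bullet> (?A - mat 1)\<bar> \<le> norm (\<Xi> i) * norm (?A - mat 1)"
    by (rule Cauchy_Schwarz_ineq2)
  moreover have "norm (\<Xi> i) * norm (?A - mat 1) \<le> x * d"
    using calculation(1) x by (intro mult_mono) (auto intro: order_trans[OF norm_ge_zero])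
  ultimately have rotation: "- (x * d) \<le> (S i ** \<Xi> i) \<bullet> S j"
    by linarith
  have attraction: "m * ((d\<^sup>2 - (norm (S j - S k))\<^sup>2) / 2 + (norm (S i - S k))\<^sup>2 / 2 * (1 - d\<^sup>2 / 2))
      \<le> a i k * ((S k - S i + S i ** half_gram (S i - S k)) \<bullet> S j)" if k: "k \<in> {1..N}" for k
  proof -
    define U where "U = half_gram (S i - S k)"
    define V where "V = half_gram (S i - S j)"
    have "U \<bullet> ?A = U \<bullet> transpose ?A"
      using inner_transpose[of U ?A] by (simp add: U_def transpose_half_gram)
    moreover have "V = mat 1 - (1 / 2) *\<^sub>R (?A + transpose ?A)"
      using half_gram_stiefel[OF St[OF i] St[OF j]] by (simp add: V_def matrix_transpose_mul)
    ultimately have "U \<bullet> ?A = U \<bullet> mat 1 - U \<bullet> V"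
      by (simp add: inner_diff_right inner_add_right)
    moreover have "U \<bullet> V \<le> (norm (S i - S k))\<^sup>2 / 2 * (d\<^sup>2 / 2)"
    proof -
      have "U \<bullet> V \<le> norm U * norm V"
        by (rule norm_cauchy_schwarz)
      also have "\<dots> \<le> (norm (S i - S k))\<^sup>2 / 2 * (d\<^sup>2 / 2)"
        unfolding U_def V_def d by (intro mult_mono norm_half_gram_le) auto
      finally show ?thesis .
    qed
    ultimately have "(norm (S i - S k))\<^sup>2 / 2 * (1 - d\<^sup>2 / 2) \<le> U \<bullet> ?A"
      by (simp add: U_def half_gram_inner_one algebra_simps)
    moreover have "(S k - S i) \<bullet> S j = (d\<^sup>2 - (norm (S j - S k))\<^sup>2) / 2"
      using inner_stiefel[OF St[OF k] St[OF j]] inner_stiefel[OF St[OF i] St[OF j]]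
      by (simp add: d inner_diff_left norm_minus_commute[of "S j" "S k"] diff_divide_distrib)
    moreover have "(S i ** U) \<bullet> S j = U \<bullet> ?A"
      by (rule inner_matrix_mult_left)
    ultimately have *: "(d\<^sup>2 - (norm (S j - S k))\<^sup>2) / 2 + (norm (S i - S k))\<^sup>2 / 2 * (1 - d\<^sup>2 / 2)
        \<le> (S k - S i + S i ** U) \<bullet> S j"
      unfolding inner_add_left by linarith
    have "(norm (S j - S k))\<^sup>2 \<le> d\<^sup>2"
      using max[OF j k] by (simp add: power_mono)
    then have "0 \<le> (d\<^sup>2 - (norm (S j - S k))\<^sup>2) / 2 + (norm (S i - S k))\<^sup>2 / 2 * (1 - d\<^sup>2 / 2)"
      using \<open>d\<^sup>2 \<le> 2\<close> by (intro add_nonneg_nonneg mult_nonneg_nonneg) auto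
    then show ?thesis
      using * m[OF k] \<open>0 \<le> m\<close> unfolding U_def by (intro mult_mono) auto
  qed
  have field: "lohe_field N \<kappa> a \<Xi> S i = S i ** \<Xi> i + (\<kappa> / real N) *\<^sub>R
    (\<Sum>k = 1..N. a i k *\<^sub>R (S k - S i + S i ** half_gram (S i - S k)))"
    using St i by (rule lohe_field_stiefel)
  have "lohe_field N \<kappa> a \<Xi> S i \<bullet> S j = (S i ** \<Xi> i) \<bullet> S j + \<kappa> / real N *
      (\<Sum>k = 1..N. a i k * ((S k - S i + S i ** half_gram (S i - S k)) \<bullet> S j))"
    unfolding field by (simp add: inner_add_left inner_sum_left)
  moreover have "\<kappa> / real N * (\<Sum>k = 1..N. m * ((d\<^sup>2 - (norm (S j - S k))\<^sup>2) / 2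
            + (norm (S i - S k))\<^sup>2 / 2 * (1 - d\<^sup>2 / 2)))
      \<le> \<kappa> / real N * (\<Sum>k = 1..N. a i k * ((S k - S i + S i ** half_gram (S i - S k)) \<bullet> S j))"
    using \<open>0 \<le> \<kappa>\<close> by (intro mult_left_mono sum_mono attraction) auto
  ultimately show ?thesis
    using rotation by linarith
qed

text \<open>
  The gain from \<open>N\<close> to \<open>N - 1\<close> is essential below: it is the source of the factors
  \<open>(N - 1) / N\<close> in both rates.
\<close>

lemma sum_le_of_zero_term:
  fixes f :: "nat \<Rightarrow> real"
  assumes "j \<in> {1..N}" "f j = 0" "\<And>k. k \<in> {1..N} \<Longrightarrow> f k \<le> B"
  shows "(\<Sum>k = 1..N. f k) \<le> (real N - 1) * B"
proof -
  have "(\<Sum>k = 1..N. f k) = (\<Sum>k\<in>{1..N} - {j}. f k)"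
    using assms(1,2) by (simp add: sum.remove)
  also have "\<dots> \<le> (\<Sum>k\<in>{1..N} - {j}. B)"
    by (intro sum_mono) (use assms(3) in auto)
  also have "\<dots> = (real N - 1) * B"
    using assms(1) by (simp add: of_nat_diff)
  finally show ?thesis .
qed

text \<open>
  Since \<open>\<parallel>S\<^sub>i - S\<^sub>j\<parallel>\<^sup>2 = 2 p - 2 S\<^sub>i \<bullet> S\<^sub>j\<close>, a lower bound for the derivative of \<open>S\<^sub>i \<bullet> S\<^sub>j\<close> bounds the
  growth of the squared distance.  Adding the estimates for \<open>(i, j)\<close> and \<open>(j, i)\<close> cancels the terms of
  second order in the distances to \<open>S\<^sub>k\<close> and leaves
  \<open>d\<^sup>2 - d\<^sup>2 / 4 * (\<parallel>S\<^sub>i - S\<^sub>k\<parallel>\<^sup>2 + \<parallel>S\<^sub>j - S\<^sub>k\<parallel>\<^sup>2)\<close> for each \<open>k\<close>.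
\<close>

lemma farthest_pair_rate:
  fixes S :: "nat \<Rightarrow> real ^ 'p ^ 'n"
  assumes St: "\<And>k. k \<in> {1..N} \<Longrightarrow> S k \<in> stiefel"
    and i: "i \<in> {1..N}" and j: "j \<in> {1..N}"
    and skew: "\<And>k. k \<in> {1..N} \<Longrightarrow> skew_symmetric (\<Xi> k)"
    and x: "\<And>k. k \<in> {1..N} \<Longrightarrow> norm (\<Xi> k) \<le> x"
    and "0 \<le> \<kappa>" "0 \<le> m" and m: "\<And>k l. k \<in> {1..N} \<Longrightarrow> l \<in> {1..N} \<Longrightarrow> m \<le> a k l"
    and d: "d = norm (S i - S j)" and "d\<^sup>2 \<le> 2"
    and max: "\<And>k l. k \<in> {1..N} \<Longrightarrow> l \<in> {1..N} \<Longrightarrow> norm (S k - S l) \<le> d"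
  shows "\<kappa> * m * (d\<^sup>2 - (real N - 1) / real N * (d\<^sup>2 * d\<^sup>2 / 2)) - 2 * x * d
      \<le> lohe_field N \<kappa> a \<Xi> S i \<bullet> S j + S i \<bullet> lohe_field N \<kappa> a \<Xi> S j"
proof -
  let ?r = "\<lambda>i j k. (d\<^sup>2 - (norm (S j - S k))\<^sup>2) / 2 + (norm (S i - S k))\<^sup>2 / 2 * (1 - d\<^sup>2 / 2)"
  let ?q = "\<lambda>i. \<Sum>k = 1..N. (norm (S i - S k))\<^sup>2"
  have "real N > 0"
    using i by auto
  have d': "d = norm (S j - S i)"
    by (simp add: d norm_minus_commute)
  have ij: "\<kappa> / real N * (\<Sum>k = 1..N. m * ?r i j k) - x * d \<le> lohe_field N \<kappa> a \<Xi> S i \<bullet> S j"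
    using St i j skew[OF i] x[OF i] \<open>0 \<le> \<kappa>\<close> \<open>0 \<le> m\<close> m[OF i] d \<open>d\<^sup>2 \<le> 2\<close> max
    by (rule inner_lohe_field_ge)
  have ji: "\<kappa> / real N * (\<Sum>k = 1..N. m * ?r j i k) - x * d \<le> lohe_field N \<kappa> a \<Xi> S j \<bullet> S i"
    using St j i skew[OF j] x[OF j] \<open>0 \<le> \<kappa>\<close> \<open>0 \<le> m\<close> m[OF j] d' \<open>d\<^sup>2 \<le> 2\<close> max
    by (rule inner_lohe_field_ge)
  have q: "?q l \<le> (real N - 1) * d\<^sup>2" if "l \<in> {1..N}" for l
    using that max by (intro sum_le_of_zero_term[where j = l]) (auto intro: power_mono)
  have "real N * d\<^sup>2 - d\<^sup>2 / 4 * (2 * ((real N - 1) * d\<^sup>2)) \<le> real N * d\<^sup>2 - d\<^sup>2 / 4 * (?q i + ?q j)"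
    using q[OF i] q[OF j] by (intro diff_left_mono mult_left_mono) auto
  also have "\<dots> = (\<Sum>k = 1..N. d\<^sup>2 - d\<^sup>2 / 4 * ((norm (S i - S k))\<^sup>2 + (norm (S j - S k))\<^sup>2))"
    by (simp add: sum_subtractf sum.distrib sum_distrib_left distrib_left)
  also have "\<dots> = (\<Sum>k = 1..N. ?r i j k) + (\<Sum>k = 1..N. ?r j i k)"
    unfolding sum.distrib[symmetric] by (intro sum.cong) (auto simp: field_simps)
  finally have "\<kappa> / real N * m * (real N * d\<^sup>2 - d\<^sup>2 / 4 * (2 * ((real N - 1) * d\<^sup>2)))
      \<le> \<kappa> / real N * m * ((\<Sum>k = 1..N. ?r i j k) + (\<Sum>k = 1..N. ?r j i k))"
    using \<open>0 \<le> \<kappa>\<close> \<open>0 \<le> m\<close> by (intro mult_left_mono) auto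
  also have "\<dots> = \<kappa> / real N * (\<Sum>k = 1..N. m * ?r i j k) + \<kappa> / real N * (\<Sum>k = 1..N. m * ?r j i k)"
    unfolding distrib_left[of "\<kappa> / real N * m"] sum_distrib_left[symmetric] by (simp only: mult.assoc)
  finally have "\<kappa> / real N * m * (real N * d\<^sup>2 - d\<^sup>2 / 4 * (2 * ((real N - 1) * d\<^sup>2))) - 2 * x * d
      \<le> lohe_field N \<kappa> a \<Xi> S i \<bullet> S j + lohe_field N \<kappa> a \<Xi> S j \<bullet> S i"
    using ij ji by linarith
  moreover have "\<kappa> / real N * m * (real N * d\<^sup>2 - d\<^sup>2 / 4 * (2 * ((real N - 1) * d\<^sup>2)))
      = \<kappa> * m * (d\<^sup>2 - (real N - 1) / real N * (d\<^sup>2 * d\<^sup>2 / 2))"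
    using \<open>real N > 0\<close> by (simp add: field_simps)
  ultimately show ?thesis
    by (simp add: inner_commute)
qed

section \<open>Distance of two families of Gram matrices\<close>

lemma transpose_lohe_field_mult:
  fixes S :: "nat \<Rightarrow> real ^ 'p ^ 'n"
  assumes St: "\<And>k. k \<in> {1..N} \<Longrightarrow> S k \<in> stiefel"
    and i: "i \<in> {1..N}" and skew: "skew_symmetric (\<Xi> i)"
  shows "transpose (lohe_field N \<kappa> a \<Xi> S i) ** S j = - (\<Xi> i ** (transpose (S i) ** S j))
    + (\<kappa> / real N) *\<^sub>R (\<Sum>k = 1..N. a i k *\<^sub>R (transpose (S k) ** S j - transpose (S i) ** S j
        + half_gram (S i - S k) ** (transpose (S i) ** S j)))"
proof -
  have field: "lohe_field N \<kappa> a \<Xi> S i = S i ** \<Xi> i + (\<kappa> / real N) *\<^sub>R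
    (\<Sum>k = 1..N. a i k *\<^sub>R (S k - S i + S i ** half_gram (S i - S k)))"
    using St i by (rule lohe_field_stiefel)
  show ?thesis
    unfolding field using skew
    by (simp add: transpose_linear_simps matrix_bilinear_simps matrix_transpose_mul
        transpose_half_gram skew_symmetric_def matrix_mul_assoc)
qed

text \<open>
  Let \<open>E\<^sub>k\<^sub>l\<close> be the difference of the Gram matrices of two families.  The rotation contributes
  \<open>- \<Xi>\<^sub>i E\<^sub>i\<^sub>j\<close>, which is orthogonal to \<open>E\<^sub>i\<^sub>j\<close>.  By \<open>half_gram_stiefel\<close>, the second
  order corrections differ by minus the symmetric part of \<open>E\<^sub>i\<^sub>k\<close>, so the attraction is
  \<open>E\<^sub>k\<^sub>j - sym E\<^sub>i\<^sub>k - E\<^sub>i\<^sub>j\<close> up to a remainder which carries a factor \<open>D + D\<^sup>2 / 2\<close> and is therefore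
  harmless for families of small spread.
\<close>

lemma inner_gram_drift_difference_le:
  fixes S T :: "nat \<Rightarrow> real ^ 'p ^ 'n"
  assumes St: "\<And>k. k \<in> {1..N} \<Longrightarrow> S k \<in> stiefel" "\<And>k. k \<in> {1..N} \<Longrightarrow> T k \<in> stiefel"
    and i: "i \<in> {1..N}" and j: "j \<in> {1..N}" and skew: "skew_symmetric (\<Xi> i)"
    and "0 \<le> \<kappa>" and a: "\<And>k. k \<in> {1..N} \<Longrightarrow> 0 \<le> a i k"
    and E_def: "\<And>k l. E k l = transpose (S k) ** S l - transpose (T k) ** T l"
    and D: "\<And>k l. k \<in> {1..N} \<Longrightarrow> l \<in> {1..N} \<Longrightarrow> norm (S k - S l) \<le> D"
           "\<And>k l. k \<in> {1..N} \<Longrightarrow> l \<in> {1..N} \<Longrightarrow> norm (T k - T l) \<le> D"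
    and max: "\<And>k l. k \<in> {1..N} \<Longrightarrow> l \<in> {1..N} \<Longrightarrow> norm (E k l) \<le> norm (E i j)"
  shows "E i j \<bullet> (transpose (lohe_field N \<kappa> a \<Xi> S i) ** S j - transpose (lohe_field N \<kappa> a \<Xi> T i) ** T j)
    \<le> \<kappa> / real N * (\<Sum>k = 1..N. a i k * (E i j \<bullet> (E k j - (1 / 2) *\<^sub>R (E i k + E k i))
        - (1 - (D + D\<^sup>2 / 2)) * (norm (E i j))\<^sup>2))"
proof -
  let ?e = "norm (E i j)"
  let ?W = "\<lambda>S k. transpose (S k) ** S j - transpose (S i) ** S j
        + half_gram (S i - S k) ** (transpose (S i) ** S j) :: real ^ 'p ^ 'p"
  have coupling: "E i j \<bullet> (?W S k - ?W T k) \<le> E i j \<bullet> (E k j - (1 / 2) *\<^sub>R (E i k + E k i))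
        - (1 - (D + D\<^sup>2 / 2)) * ?e\<^sup>2" if k: "k \<in> {1..N}" for k
  proof -
    define U where "U = half_gram (S i - S k)"
    define Y where "Y = (1 / 2) *\<^sub>R (E i k + E k i)"
    define B where "B = transpose (T i) ** T j"
    have V: "half_gram (T i - T k) = U + Y"
      by (simp add: U_def Y_def E_def half_gram_stiefel St(1)[OF i] St(1)[OF k] St(2)[OF i]
          St(2)[OF k] algebra_simps)
    have "?W S k - ?W T k = E k j - Y - E i j + U ** E i j - Y ** (B - mat 1)"
      unfolding V by (simp add: U_def[symmetric] B_def E_def matrix_bilinear_simps algebra_simps)
    then have "E i j \<bullet> (?W S k - ?W T k) = E i j \<bullet> (E k j - Y) - ?e\<^sup>2
        + E i j \<bullet> (U ** E i j) - E i j \<bullet> (Y ** (B - mat 1))"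
      by (simp add: inner_diff_right inner_add_right power2_norm_eq_inner)
    moreover have "E i j \<bullet> (U ** E i j) \<le> D\<^sup>2 / 2 * ?e\<^sup>2"
    proof -
      have "norm U \<le> D\<^sup>2 / 2"
        using norm_half_gram_le[of "S i - S k"] power_mono[OF D(1)[OF i k], of 2]
        by (simp add: U_def)
      then have "norm (U ** E i j) \<le> D\<^sup>2 / 2 * ?e"
        using norm_matrix_mult_le[of U "E i j"] by (meson mult_right_mono norm_ge_zero order_trans)
      then have "?e * norm (U ** E i j) \<le> ?e * (D\<^sup>2 / 2 * ?e)"
        by (intro mult_left_mono) auto
      then show ?thesis
        using norm_cauchy_schwarz[of "E i j" "U ** E i j"] by (simp add: power2_eq_square mult_ac)
    qed
    moreover have "- (E i j \<bullet> (Y ** (B - mat 1))) \<le> D * ?e\<^sup>2"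
    proof -
      have "norm Y \<le> ?e"
        using norm_triangle_ineq[of "E i k" "E k i"] max[OF i k] max[OF k i] by (simp add: Y_def)
      moreover have "norm (B - mat 1) \<le> D"
        using norm_gram_minus_one_le[OF St(2)[OF i], of "T j"] D(2)[OF i j] by (simp add: B_def)
      ultimately have "norm (Y ** (B - mat 1)) \<le> ?e * D"
        using norm_matrix_mult_le[of Y "B - mat 1"] by (meson mult_mono norm_ge_zero order_trans)
      then have "?e * norm (Y ** (B - mat 1)) \<le> ?e * (?e * D)"
        by (intro mult_left_mono) auto
      then show ?thesis
        using norm_cauchy_schwarz[of "E i j" "- (Y ** (B - mat 1))"]
        by (simp add: power2_eq_square mult_ac)
    qed
    ultimately show ?thesis
      unfolding Y_def by (simp add: algebra_simps)
  qed
  have "transpose (lohe_field N \<kappa> a \<Xi> S i) ** S j - transpose (lohe_field N \<kappa> a \<Xi> T i) ** T j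
      = - (\<Xi> i ** E i j) + (\<kappa> / real N) *\<^sub>R (\<Sum>k = 1..N. a i k *\<^sub>R (?W S k - ?W T k))"
  proof -
    have "transpose (lohe_field N \<kappa> a \<Xi> S i) ** S j = - (\<Xi> i ** (transpose (S i) ** S j))
        + (\<kappa> / real N) *\<^sub>R (\<Sum>k = 1..N. a i k *\<^sub>R ?W S k)"
      using St(1) i skew by (rule transpose_lohe_field_mult)
    moreover have "transpose (lohe_field N \<kappa> a \<Xi> T i) ** T j = - (\<Xi> i ** (transpose (T i) ** T j))
        + (\<kappa> / real N) *\<^sub>R (\<Sum>k = 1..N. a i k *\<^sub>R ?W T k)"
      using St(2) i skew by (rule transpose_lohe_field_mult)
    moreover have "(- x + c *\<^sub>R (\<Sum>k = 1..N. a i k *\<^sub>R w k)) - (- y + c *\<^sub>R (\<Sum>k = 1..N. a i k *\<^sub>R v k))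
        = - (x - y) + c *\<^sub>R (\<Sum>k = 1..N. a i k *\<^sub>R (w k - v k))"
      for c and x y :: "real ^ 'p ^ 'p" and w v
      by (simp add: scaleR_diff_right sum_subtractf)
    ultimately show ?thesis
      by (simp only: E_def bounded_bilinear.diff_right[OF bounded_bilinear_matrix_mult])
  qed
  then have "E i j \<bullet> (transpose (lohe_field N \<kappa> a \<Xi> S i) ** S j - transpose (lohe_field N \<kappa> a \<Xi> T i) ** T j)
      = \<kappa> / real N * (\<Sum>k = 1..N. a i k * (E i j \<bullet> (?W S k - ?W T k)))"
    by (simp only: inner_add_right inner_minus_right inner_skew_symmetric_mult[OF skew]
        inner_scaleR_right inner_sum_right minus_zero add_0_left)
  also have "\<dots> \<le> \<kappa> / real N * (\<Sum>k = 1..N. a i k * (E i j \<bullet> (E k j - (1 / 2) *\<^sub>R (E i k + E k i))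
        - (1 - (D + D\<^sup>2 / 2)) * ?e\<^sup>2))"
    using \<open>0 \<le> \<kappa>\<close> a coupling by (intro mult_left_mono sum_mono) auto
  finally show ?thesis .
qed

text \<open>
  Splitting \<open>X\<close> and \<open>Y\<close> into symmetric and skew parts turns the weighted combination into
  \<open>b skew X + c skew Y + (b - c) (sym X - sym Y)\<close>: the symmetric parts would cancel for equal weights,
  so they are charged only to the difference of the weights.
\<close>

lemma weighted_exchange_le:
  fixes E X Y :: "real ^ 'p ^ 'p" and b c :: real
  assumes "0 \<le> b" "b \<le> M" "0 \<le> c" "c \<le> M" "\<bar>b - c\<bar> \<le> \<delta>"
  shows "b * (E \<bullet> (X - (1 / 2) *\<^sub>R (Y + transpose Y))) + c * (E \<bullet> (Y - (1 / 2) *\<^sub>R (X + transpose X)))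
    \<le> (M + \<delta>) * norm E * (norm X + norm Y)"
proof -
  define sy sk :: "real ^ 'p ^ 'p \<Rightarrow> real ^ 'p ^ 'p"
    where "sy Z = (1 / 2) *\<^sub>R (Z + transpose Z)" and "sk Z = (1 / 2) *\<^sub>R (Z - transpose Z)" for Z
  have split: "sy Z + sk Z = Z" for Z
    by (simp add: sy_def sk_def scaleR_add_right scaleR_diff_right flip: scaleR_left_distrib)
  have n: "norm (sy Z) \<le> norm Z" "norm (sk Z) \<le> norm Z" for Z
    using norm_triangle_ineq[of Z "transpose Z"] norm_triangle_ineq4[of Z "transpose Z"]
    by (simp_all add: sy_def sk_def norm_transpose)
  have "b *\<^sub>R (X - sy Y) + c *\<^sub>R (Y - sy X) = b *\<^sub>R sk X + c *\<^sub>R sk Y + (b - c) *\<^sub>R (sy X - sy Y)"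
  proof -
    have "b *\<^sub>R ((sy X + sk X) - sy Y) + c *\<^sub>R ((sy Y + sk Y) - sy X)
        = b *\<^sub>R sk X + c *\<^sub>R sk Y + (b - c) *\<^sub>R (sy X - sy Y)"
      by (simp add: algebra_simps)
    then show ?thesis
      by (simp only: split)
  qed
  then have "norm (b *\<^sub>R (X - sy Y) + c *\<^sub>R (Y - sy X))
      \<le> norm (b *\<^sub>R sk X) + norm (c *\<^sub>R sk Y) + norm ((b - c) *\<^sub>R (sy X - sy Y))"
    by (metis norm_triangle_mono norm_triangle_ineq order_refl)
  also have "\<dots> \<le> M * norm X + M * norm Y + \<delta> * (norm X + norm Y)"
  proof (intro add_mono)
    show "norm (b *\<^sub>R sk X) \<le> M * norm X" "norm (c *\<^sub>R sk Y) \<le> M * norm Y"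
      using assms n by (auto intro!: mult_mono)
    have "norm (sy X - sy Y) \<le> norm X + norm Y"
      using norm_triangle_ineq4[of "sy X" "sy Y"] n(1)[of X] n(1)[of Y] by linarith
    then show "norm ((b - c) *\<^sub>R (sy X - sy Y)) \<le> \<delta> * (norm X + norm Y)"
      using assms by (auto intro!: mult_mono)
  qed
  finally have "norm E * norm (b *\<^sub>R (X - sy Y) + c *\<^sub>R (Y - sy X)) \<le> norm E * ((M + \<delta>) * (norm X + norm Y))"
    by (intro mult_left_mono) (auto simp: algebra_simps)
  then have "E \<bullet> (b *\<^sub>R (X - sy Y) + c *\<^sub>R (Y - sy X)) \<le> norm E * ((M + \<delta>) * (norm X + norm Y))"
    using norm_cauchy_schwarz order_trans by blast
  then show ?thesis
    by (simp add: inner_add_right sy_def mult_ac)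
qed

text \<open>
  The terms \<open>- E\<^sub>i\<^sub>j\<close> of the linearised drift damp at the rate of the smallest weight, and the
  remaining terms of both one-sided drifts combine by \<open>weighted_exchange_le\<close>.  The diagonal differences
  \<open>E\<^sub>k\<^sub>k\<close> vanish, so only \<open>N - 1\<close> of the \<open>N\<close> summands count against the damping; this balance is
  exactly the constant \<open>\<Lambda>\<close>.
\<close>

lemma gram_distance_rate:
  fixes S T :: "nat \<Rightarrow> real ^ 'p ^ 'n"
  assumes St: "\<And>k. k \<in> {1..N} \<Longrightarrow> S k \<in> stiefel" "\<And>k. k \<in> {1..N} \<Longrightarrow> T k \<in> stiefel"
    and i: "i \<in> {1..N}" and j: "j \<in> {1..N}"
    and skew: "\<And>k. k \<in> {1..N} \<Longrightarrow> skew_symmetric (\<Xi> k)"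
    and "0 \<le> \<kappa>" "0 \<le> m"
    and a: "\<And>k l. k \<in> {1..N} \<Longrightarrow> l \<in> {1..N} \<Longrightarrow> m \<le> a k l"
           "\<And>k l. k \<in> {1..N} \<Longrightarrow> l \<in> {1..N} \<Longrightarrow> a k l \<le> M"
           "\<And>k l r. k \<in> {1..N} \<Longrightarrow> l \<in> {1..N} \<Longrightarrow> r \<in> {1..N} \<Longrightarrow> \<bar>a k r - a l r\<bar> \<le> \<delta>"
    and E_def: "\<And>k l. E k l = transpose (S k) ** S l - transpose (T k) ** T l"
    and D: "\<And>k l. k \<in> {1..N} \<Longrightarrow> l \<in> {1..N} \<Longrightarrow> norm (S k - S l) \<le> D"
           "\<And>k l. k \<in> {1..N} \<Longrightarrow> l \<in> {1..N} \<Longrightarrow> norm (T k - T l) \<le> D"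
    and max: "\<And>k l. k \<in> {1..N} \<Longrightarrow> l \<in> {1..N} \<Longrightarrow> norm (E k l) \<le> norm (E i j)"
  shows "E i j \<bullet> ((transpose (lohe_field N \<kappa> a \<Xi> S i) ** S j + transpose (S i) ** lohe_field N \<kappa> a \<Xi> S j)
      - (transpose (lohe_field N \<kappa> a \<Xi> T i) ** T j + transpose (T i) ** lohe_field N \<kappa> a \<Xi> T j))
    \<le> - 2 * \<kappa> * (m - (real N - 1) / real N * (M + \<delta>) - M * (D + D\<^sup>2 / 2)) * (norm (E i j))\<^sup>2"
proof -
  let ?F = "lohe_field N \<kappa> a \<Xi>"
  let ?e = "norm (E i j)" and ?\<rho> = "D + D\<^sup>2 / 2"
  have "real N > 0"
    using i by auto
  have "0 \<le> D"
    using D(1)[OF i i] by simp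
  then have "0 \<le> ?\<rho>"
    by simp
  have "0 \<le> M"
    using a(1,2)[OF i i] \<open>0 \<le> m\<close> by linarith
  have "0 \<le> \<delta>"
    using a(3)[OF i i i] by simp
  have tr: "transpose (E k l) = E l k" for k l
    by (simp add: E_def transpose_linear_simps matrix_transpose_mul)
  have ne: "norm (E j i) = ?e"
    using norm_transpose[of "E i j"] by (simp add: tr)
  have a0: "0 \<le> a k l" if "k \<in> {1..N}" "l \<in> {1..N}" for k l
    using a(1)[OF that] \<open>0 \<le> m\<close> by linarith
  have ij: "E i j \<bullet> (transpose (?F S i) ** S j - transpose (?F T i) ** T j)
    \<le> \<kappa> / real N * (\<Sum>k = 1..N. a i k * (E i j \<bullet> (E k j - (1 / 2) *\<^sub>R (E i k + E k i))
        - (1 - ?\<rho>) * ?e\<^sup>2))"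
    using St i j skew[OF i] \<open>0 \<le> \<kappa>\<close> a0[OF i] E_def D max by (rule inner_gram_drift_difference_le)
  have ji: "E j i \<bullet> (transpose (?F S j) ** S i - transpose (?F T j) ** T i)
    \<le> \<kappa> / real N * (\<Sum>k = 1..N. a j k * (E j i \<bullet> (E k i - (1 / 2) *\<^sub>R (E j k + E k j))
        - (1 - ?\<rho>) * (norm (E j i))\<^sup>2))"
    using St j i skew[OF j] \<open>0 \<le> \<kappa>\<close> a0[OF j] E_def D max[folded ne]
    by (rule inner_gram_drift_difference_le)
  have flip: "E j i \<bullet> (transpose (?F S j) ** S i - transpose (?F T j) ** T i)
      = E i j \<bullet> (transpose (S i) ** ?F S j - transpose (T i) ** ?F T j)"
    using inner_transpose[of "E i j" "transpose (S i) ** ?F S j - transpose (T i) ** ?F T j"]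
    by (simp add: tr transpose_linear_simps matrix_transpose_mul)
  have flip': "E j i \<bullet> (E k i - (1 / 2) *\<^sub>R (E j k + E k j)) = E i j \<bullet> (E i k - (1 / 2) *\<^sub>R (E k j + E j k))" for k
    using inner_transpose[of "E i j" "E i k - (1 / 2) *\<^sub>R (E k j + E j k)"]
    by (simp add: tr transpose_linear_simps)
  have each: "a i k * (E i j \<bullet> (E k j - (1 / 2) *\<^sub>R (E i k + E k i)) - (1 - ?\<rho>) * ?e\<^sup>2)
      + a j k * (E j i \<bullet> (E k i - (1 / 2) *\<^sub>R (E j k + E k j)) - (1 - ?\<rho>) * ?e\<^sup>2)
      \<le> (2 * ?\<rho> * M - 2 * m) * ?e\<^sup>2 + (M + \<delta>) * ?e * (norm (E k j) + norm (E i k))"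
    if k: "k \<in> {1..N}" for k
  proof -
    have "a i k * (E i j \<bullet> (E k j - (1 / 2) *\<^sub>R (E i k + transpose (E i k))))
        + a j k * (E i j \<bullet> (E i k - (1 / 2) *\<^sub>R (E k j + transpose (E k j))))
        \<le> (M + \<delta>) * ?e * (norm (E k j) + norm (E i k))"
      using i j k a a0 by (intro weighted_exchange_le) auto
    moreover have "(a i k + a j k) * (?\<rho> * ?e\<^sup>2) \<le> (2 * M) * (?\<rho> * ?e\<^sup>2)"
      using a(2)[OF i k] a(2)[OF j k] \<open>0 \<le> ?\<rho>\<close> by (intro mult_right_mono) auto
    moreover have "(2 * m) * ?e\<^sup>2 \<le> (a i k + a j k) * ?e\<^sup>2"
      using a(1)[OF i k] a(1)[OF j k] by (intro mult_right_mono) auto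
    moreover have "b * (u - (1 - r) * s) + c * (v - (1 - r) * s) \<le> (2 * r * M - 2 * m) * s + w"
      if "b * u + c * v \<le> w" "(b + c) * (r * s) \<le> (2 * M) * (r * s)" "(2 * m) * s \<le> (b + c) * s"
      for b c u v r s w :: real
      using that by (simp add: algebra_simps)
    ultimately show ?thesis
      unfolding flip' tr by blast
  qed
  have diag: "E k k = 0" if "k \<in> {1..N}" for k
    using St that by (simp add: E_def stiefel_def)
  have col: "(\<Sum>k = 1..N. norm (E k j)) \<le> (real N - 1) * ?e"
    using diag j max by (intro sum_le_of_zero_term[where j = j]) auto
  have row: "(\<Sum>k = 1..N. norm (E i k)) \<le> (real N - 1) * ?e"
    using diag i max by (intro sum_le_of_zero_term[where j = i]) auto
  have "(\<Sum>k = 1..N. a i k * (E i j \<bullet> (E k j - (1 / 2) *\<^sub>R (E i k + E k i)) - (1 - ?\<rho>) * ?e\<^sup>2))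
      + (\<Sum>k = 1..N. a j k * (E j i \<bullet> (E k i - (1 / 2) *\<^sub>R (E j k + E k j)) - (1 - ?\<rho>) * ?e\<^sup>2))
      \<le> (\<Sum>k = 1..N. (2 * ?\<rho> * M - 2 * m) * ?e\<^sup>2 + (M + \<delta>) * ?e * (norm (E k j) + norm (E i k)))"
    unfolding sum.distrib[symmetric] by (intro sum_mono each)
  also have "\<dots> = real N * ((2 * ?\<rho> * M - 2 * m) * ?e\<^sup>2)
      + (M + \<delta>) * ?e * ((\<Sum>k = 1..N. norm (E k j)) + (\<Sum>k = 1..N. norm (E i k)))"
    by (simp add: sum.distrib flip: sum_distrib_left)
  also have "\<dots> \<le> real N * ((2 * ?\<rho> * M - 2 * m) * ?e\<^sup>2) + (M + \<delta>) * ?e * (2 * ((real N - 1) * ?e))"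
    using row col \<open>0 \<le> M\<close> \<open>0 \<le> \<delta>\<close> by (intro add_left_mono mult_left_mono) auto
  finally have "\<kappa> / real N * ((\<Sum>k = 1..N. a i k * (E i j \<bullet> (E k j - (1 / 2) *\<^sub>R (E i k + E k i)) - (1 - ?\<rho>) * ?e\<^sup>2))
      + (\<Sum>k = 1..N. a j k * (E j i \<bullet> (E k i - (1 / 2) *\<^sub>R (E j k + E k j)) - (1 - ?\<rho>) * ?e\<^sup>2)))
      \<le> \<kappa> / real N * (real N * ((2 * ?\<rho> * M - 2 * m) * ?e\<^sup>2) + (M + \<delta>) * ?e * (2 * ((real N - 1) * ?e)))"
    using \<open>0 \<le> \<kappa>\<close> by (intro mult_left_mono) auto
  also have "\<dots> = - 2 * \<kappa> * (m - (real N - 1) / real N * (M + \<delta>) - M * ?\<rho>) * ?e\<^sup>2"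
    using \<open>real N > 0\<close> by (simp add: field_simps power2_eq_square)
  finally show ?thesis
    using ij ji unfolding flip ne
    by (simp only: distrib_left inner_diff_right inner_add_right)
qed

section \<open>Solutions\<close>

lemma global_solution_shift:
  assumes sol: "global_solution N \<kappa> a \<Xi> Sin S" and "0 \<le> s"
  shows "global_solution N \<kappa> a \<Xi> (\<lambda>i. S i s) (\<lambda>i t. S i (t + s))"
  unfolding global_solution_def
proof (intro ballI conjI allI impI)
  fix i and t :: real assume i: "i \<in> {1..N}" and t: "0 \<le> t"
  show "S i (t + s) \<in> stiefel"
    using sol i t \<open>0 \<le> s\<close> by (auto simp: global_solution_def)
  have "(S i has_vector_derivative lohe_field N \<kappa> a \<Xi> (\<lambda>k. S k (t + s)) i) (at (t + s) within {0..})"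
    using sol i t \<open>0 \<le> s\<close> by (auto simp: global_solution_def)
  then have "(S i has_vector_derivative lohe_field N \<kappa> a \<Xi> (\<lambda>k. S k (t + s)) i)
      (at (t + s) within (\<lambda>t. t + s) ` {0..})"
    by (rule has_vector_derivative_within_subset) (use \<open>0 \<le> s\<close> in auto)
  moreover have "((\<lambda>t. t + s) has_vector_derivative 1) (at t within {0..})"
    by (auto intro!: derivative_eq_intros)
  ultimately show "((\<lambda>t. S i (t + s)) has_vector_derivative lohe_field N \<kappa> a \<Xi> (\<lambda>k. S k (t + s)) i)
      (at t within {0..})"
    using vector_diff_chain_within[of "\<lambda>t. t + s" 1 t "{0..}" "S i"] by (simp add: o_def)
qed simp

lemma exp_decay_tendsto_0:
  fixes c t0 :: real
  assumes "0 < c"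
  shows "((\<lambda>t. exp (- c * (t - t0))) \<longlongrightarrow> 0) at_top"
proof -
  have "filterlim (\<lambda>t. - t0 + t) at_top at_top"
    by (rule filterlim_tendsto_add_at_top[OF tendsto_const filterlim_ident])
  then have "filterlim (\<lambda>t. - c * (- t0 + t)) at_bot at_top"
    using assms by (intro filterlim_tendsto_neg_mult_at_bot[OF tendsto_const]) auto
  then show ?thesis
    by (intro filterlim_compose[OF exp_at_bot]) (simp add: add.commute)
qed

text \<open>
  The restoring force at distance \<open>d\<close> equals \<open>d (1 - d\<^sup>2 / 2) + d\<^sup>3 / (2 n)\<close>.  The first summand is
  enough up to \<open>d = 1\<close> but vanishes at \<open>d = \<surd>2\<close>; beyond \<open>1\<close> the second one takes over.
\<close>

lemma cubic_gap:
  fixes n l d :: real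
  assumes "2 \<le> n" "0 < l" "l \<le> 1 / n" "3 / 4 * l \<le> d" "d\<^sup>2 \<le> 2"
  shows "l / 2 \<le> d - (n - 1) / n * (d ^ 3 / 2)"
proof -
  have "0 < d"
    using assms by linarith
  have "1 / n \<le> 1 / 2"
    using \<open>2 \<le> n\<close> by (simp add: field_simps)
  then have "l \<le> 1 / 2"
    using \<open>l \<le> 1 / n\<close> by linarith
  have split: "d - (n - 1) / n * (d ^ 3 / 2) = d * (1 - d\<^sup>2 / 2) + d ^ 3 / (2 * n)"
    using \<open>2 \<le> n\<close> by (simp add: field_simps power2_eq_square power3_eq_cube)
  have pos: "0 \<le> d ^ 3 / (2 * n)"
    using \<open>0 < d\<close> \<open>2 \<le> n\<close> by simp
  consider "d \<le> 1 / 2" | "1 / 2 \<le> d" "d \<le> 1" | "1 \<le> d"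
    by linarith
  then show ?thesis
  proof cases
    case 1
    have "d\<^sup>2 \<le> (1 / 2)\<^sup>2"
      using 1 \<open>0 < d\<close> by (intro power_mono) auto
    then have "d * (7 / 8) \<le> d * (1 - d\<^sup>2 / 2)"
      using \<open>0 < d\<close> by (intro mult_left_mono) (auto simp: power2_eq_square)
    then show ?thesis
      unfolding split using pos assms by linarith
  next
    case 2
    have "d\<^sup>2 \<le> 1\<^sup>2"
      using 2 \<open>0 < d\<close> by (intro power_mono) auto
    then have "d * (1 / 2) \<le> d * (1 - d\<^sup>2 / 2)"
      using \<open>0 < d\<close> by (intro mult_left_mono) auto
    then show ?thesis
      unfolding split using pos 2 \<open>l \<le> 1 / 2\<close> by linarith
  next
    case 3
    have "1 / (2 * n) \<le> d ^ 3 / (2 * n)"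
      using 3 \<open>2 \<le> n\<close> by (intro divide_right_mono) (auto simp: one_le_power)
    moreover have "0 \<le> d * (1 - d\<^sup>2 / 2)"
      using \<open>0 < d\<close> \<open>d\<^sup>2 \<le> 2\<close> by simp
    moreover have "l / 2 \<le> 1 / (2 * n)"
      using \<open>l \<le> 1 / n\<close> by simp
    ultimately show ?thesis
      unfolding split by linarith
  qed
qed

text \<open>
  While the spread lies between \<open>\<mu>\<close> and \<open>\<surd>2\<close>, its square decreases at speed at least \<open>2 \<mu> \<epsilon>\<close>.  The
  barrier descends from \<open>2\<close> to \<open>\<mu>\<^sup>2\<close> exponentially, slowly enough never to exceed half that speed.
\<close>

lemma spread_eventually_le:
  fixes S :: "nat \<Rightarrow> real \<Rightarrow> real ^ 'p ^ 'n"
  assumes sol: "global_solution N \<kappa> a \<Xi> Sin S"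
    and skew: "\<And>k. k \<in> {1..N} \<Longrightarrow> skew_symmetric (\<Xi> k)"
    and x: "\<And>k. k \<in> {1..N} \<Longrightarrow> norm (\<Xi> k) \<le> x"
    and "0 \<le> \<kappa>" "0 \<le> m" and m: "\<And>k l. k \<in> {1..N} \<Longrightarrow> l \<in> {1..N} \<Longrightarrow> m \<le> a k l"
    and init: "\<And>k l. k \<in> {1..N} \<Longrightarrow> l \<in> {1..N} \<Longrightarrow> (norm (Sin k - Sin l))\<^sup>2 < 2"
    and "0 < \<mu>" "\<mu>\<^sup>2 \<le> 2" "\<mu> < \<nu>" "0 < \<epsilon>"
    and gap: "\<And>d. \<mu> \<le> d \<Longrightarrow> d\<^sup>2 \<le> 2 \<Longrightarrow> \<epsilon> \<le> \<kappa> * m * (d - (real N - 1) / real N * (d ^ 3 / 2)) - 2 * x"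
  obtains t0 where "0 \<le> t0"
    "\<And>t i j. t0 \<le> t \<Longrightarrow> i \<in> {1..N} \<Longrightarrow> j \<in> {1..N} \<Longrightarrow> norm (S i t - S j t) \<le> \<nu>"
proof -
  let ?P = "{1..N} \<times> {1..N}"
  let ?F = "\<lambda>i t. lohe_field N \<kappa> a \<Xi> (\<lambda>k. S k t) i"
  \<comment> \<open>for points of the Stiefel manifold this is the squared distance\<close>
  define f where "f = (\<lambda>(i, j) t. 2 * (real CARD('p) - S i t \<bullet> S j t))"
  define f' where "f' = (\<lambda>(i, j) t. - 2 * (?F i t \<bullet> S j t + S i t \<bullet> ?F j t))"
  define c where "c = \<mu> * \<epsilon> / 2"
  define h where "h = (\<lambda>t. \<mu>\<^sup>2 + (2 - \<mu>\<^sup>2) * exp (- c * t))"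
  define h' where "h' = (\<lambda>t. - c * ((2 - \<mu>\<^sup>2) * exp (- c * t)))"
  have "0 < c"
    using \<open>0 < \<mu>\<close> \<open>0 < \<epsilon>\<close> by (simp add: c_def)
  have St: "S i t \<in> stiefel" if "i \<in> {1..N}" "0 \<le> t" for i t
    using sol that by (auto simp: global_solution_def)
  have f: "f (i, j) t = (norm (S i t - S j t))\<^sup>2" if "i \<in> {1..N}" "j \<in> {1..N}" "0 \<le> t" for i j t
    using inner_stiefel[OF St[OF that(1,3)] St[OF that(2,3)]] by (simp add: f_def)
  have below: "f p t < h t" if "p \<in> ?P" "0 \<le> t" for p t
  proof (rule finite_family_below_barrier[where P = ?P and f = f and h = h and f' = f' and h' = h'])
    fix p assume "p \<in> ?P"
    then show "f p 0 < h 0"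
      using f[of "fst p" "snd p" 0] init[of "fst p" "snd p"] sol
      by (auto simp: global_solution_def h_def)
  next
    fix p and t :: real assume "p \<in> ?P" "0 \<le> t"
    then have d: "(S i has_vector_derivative ?F i t) (at t within {0..})" if "i \<in> {fst p, snd p}" for i
      using sol that by (auto simp: global_solution_def)
    have "((\<lambda>t. S (fst p) t \<bullet> S (snd p) t) has_vector_derivative
        S (fst p) t \<bullet> ?F (snd p) t + ?F (fst p) t \<bullet> S (snd p) t) (at t within {0..})"
      by (intro bounded_bilinear.has_vector_derivative[OF bounded_bilinear_inner] d) auto
    then have "((\<lambda>t. S (fst p) t \<bullet> S (snd p) t) has_real_derivative
        S (fst p) t \<bullet> ?F (snd p) t + ?F (fst p) t \<bullet> S (snd p) t) (at t within {0..})"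
      by (simp add: has_real_derivative_iff_has_vector_derivative)
    note DERIV_cmult[OF DERIV_diff[OF DERIV_const this], of 2 "real CARD('p)"]
    then show "(f p has_real_derivative f' p t) (at t within {0..})"
      by (simp add: f_def f'_def case_prod_beta algebra_simps)
  next
    fix t :: real assume "0 \<le> t"
    show "(h has_real_derivative h' t) (at t within {0..})"
      unfolding h_def h'_def by (auto intro!: derivative_eq_intros)
  next
    fix p and t :: real
    assume p: "p \<in> ?P" and "0 < t" and touch: "f p t = h t" and le: "\<And>q. q \<in> ?P \<Longrightarrow> f q t \<le> h t"
    obtain i j where ij: "p = (i, j)" "i \<in> {1..N}" "j \<in> {1..N}"
      using p by auto
    have "0 \<le> t"
      using \<open>0 < t\<close> by simp
    define d where "d = norm (S i t - S j t)"
    have d2: "d\<^sup>2 = h t"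
      using touch f[OF ij(2,3) \<open>0 \<le> t\<close>] by (simp add: d_def ij)
    have "exp (- c * t) \<le> 1"
      using \<open>0 < c\<close> \<open>0 \<le> t\<close> by simp
    then have decay: "0 \<le> (2 - \<mu>\<^sup>2) * exp (- c * t)" "(2 - \<mu>\<^sup>2) * exp (- c * t) \<le> 2 - \<mu>\<^sup>2"
      using \<open>\<mu>\<^sup>2 \<le> 2\<close> by (auto intro: mult_left_le)
    then have "\<mu>\<^sup>2 \<le> d\<^sup>2" "d\<^sup>2 \<le> 2"
      by (simp_all add: d2 h_def)
    have "\<mu> \<le> d"
      using \<open>\<mu>\<^sup>2 \<le> d\<^sup>2\<close> by (rule power2_le_imp_le) (simp add: d_def)
    have max: "norm (S k t - S l t) \<le> d" if "k \<in> {1..N}" "l \<in> {1..N}" for k l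
    proof -
      have "(norm (S k t - S l t))\<^sup>2 \<le> d\<^sup>2"
        using le[of "(k, l)"] that f[OF that \<open>0 \<le> t\<close>] by (simp add: d2)
      then show ?thesis
        by (rule power2_le_imp_le) (simp add: d_def)
    qed
    have "\<kappa> * m * (d\<^sup>2 - (real N - 1) / real N * (d\<^sup>2 * d\<^sup>2 / 2)) - 2 * x * d
        \<le> ?F i t \<bullet> S j t + S i t \<bullet> ?F j t"
      by (rule farthest_pair_rate[where S = "\<lambda>k. S k t"])
        (use St \<open>0 \<le> t\<close> ij skew x \<open>0 \<le> \<kappa>\<close> \<open>0 \<le> m\<close> m d_def \<open>d\<^sup>2 \<le> 2\<close> max in auto)
    moreover have "\<kappa> * m * (d\<^sup>2 - (real N - 1) / real N * (d\<^sup>2 * d\<^sup>2 / 2)) - 2 * x * d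
        = d * (\<kappa> * m * (d - (real N - 1) / real N * (d ^ 3 / 2)) - 2 * x)"
      by (simp add: power2_eq_square power3_eq_cube algebra_simps)
    moreover have "\<mu> * \<epsilon> \<le> d * (\<kappa> * m * (d - (real N - 1) / real N * (d ^ 3 / 2)) - 2 * x)"
      using \<open>\<mu> \<le> d\<close> \<open>0 < \<mu>\<close> \<open>0 < \<epsilon>\<close> gap[OF \<open>\<mu> \<le> d\<close> \<open>d\<^sup>2 \<le> 2\<close>] by (intro mult_mono) auto
    ultimately have "f' p t \<le> - 2 * (\<mu> * \<epsilon>)"
      by (simp add: f'_def ij)
    moreover have "(2 - \<mu>\<^sup>2) * exp (- c * t) \<le> 2"
      using decay(2) zero_le_power2[of \<mu>] by linarith
    then have "c * ((2 - \<mu>\<^sup>2) * exp (- c * t)) \<le> c * 2"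
      using \<open>0 < c\<close> by (intro mult_left_mono) auto
    moreover have "0 < \<mu> * \<epsilon>"
      using \<open>0 < \<mu>\<close> \<open>0 < \<epsilon>\<close> by simp
    ultimately show "f' p t < h' t"
      unfolding h'_def by (simp add: c_def)
  qed (use that in auto)
  have "((\<lambda>t. exp (- c * t)) \<longlongrightarrow> 0) at_top"
    using exp_decay_tendsto_0[OF \<open>0 < c\<close>, of 0] by simp
  then have "(h \<longlongrightarrow> \<mu>\<^sup>2 + (2 - \<mu>\<^sup>2) * 0) at_top"
    unfolding h_def by (intro tendsto_intros)
  moreover have "\<mu>\<^sup>2 < \<nu>\<^sup>2"
    using \<open>0 < \<mu>\<close> \<open>\<mu> < \<nu>\<close> by (intro power_strict_mono) auto
  ultimately have "eventually (\<lambda>t. h t < \<nu>\<^sup>2) at_top"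
    by (intro order_tendstoD) auto
  then obtain t1 where t1: "\<And>t. t1 \<le> t \<Longrightarrow> h t < \<nu>\<^sup>2"
    by (auto simp: eventually_at_top_linorder)
  show thesis
  proof (rule that[of "max 0 t1"])
    fix t i j assume "max 0 t1 \<le> t" and ij: "i \<in> {1..N}" "j \<in> {1..N}"
    then have "(norm (S i t - S j t))\<^sup>2 \<le> \<nu>\<^sup>2"
      using below[of "(i, j)" t] f[OF ij, of t] t1[of t] by auto
    then show "norm (S i t - S j t) \<le> \<nu>"
      by (rule power2_le_imp_le) (use \<open>0 < \<mu>\<close> \<open>\<mu> < \<nu>\<close> in linarith)
  qed simp
qed

text \<open>
  The largest Gram difference decays because \<open>gram_distance_rate\<close> applies to a maximal pair on the
  barrier.  The prefactor depends on \<open>p\<close> only, so the decay is uniform over all pairs of solutions of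
  spread at most \<open>D\<close>.
\<close>

lemma gram_difference_decay:
  fixes S T :: "nat \<Rightarrow> real \<Rightarrow> real ^ 'p ^ 'n"
  assumes sol: "global_solution N \<kappa> a \<Xi> Sin S" "global_solution N \<kappa> a \<Xi> Tin T"
    and skew: "\<And>k. k \<in> {1..N} \<Longrightarrow> skew_symmetric (\<Xi> k)"
    and "0 \<le> \<kappa>" "0 \<le> m"
    and a: "\<And>k l. k \<in> {1..N} \<Longrightarrow> l \<in> {1..N} \<Longrightarrow> m \<le> a k l"
           "\<And>k l. k \<in> {1..N} \<Longrightarrow> l \<in> {1..N} \<Longrightarrow> a k l \<le> M"
           "\<And>k l r. k \<in> {1..N} \<Longrightarrow> l \<in> {1..N} \<Longrightarrow> r \<in> {1..N} \<Longrightarrow> \<bar>a k r - a l r\<bar> \<le> \<delta>"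
    and D: "\<And>k l t. k \<in> {1..N} \<Longrightarrow> l \<in> {1..N} \<Longrightarrow> 0 \<le> t \<Longrightarrow> norm (S k t - S l t) \<le> D"
           "\<And>k l t. k \<in> {1..N} \<Longrightarrow> l \<in> {1..N} \<Longrightarrow> 0 \<le> t \<Longrightarrow> norm (T k t - T l t) \<le> D"
    and r: "r = 2 * \<kappa> * (m - (real N - 1) / real N * (M + \<delta>) - M * (D + D\<^sup>2 / 2))" and "0 < r"
    and i: "i \<in> {1..N}" and j: "j \<in> {1..N}" and "0 \<le> t"
  shows "(norm (transpose (S i t) ** S j t - transpose (T i t) ** T j t))\<^sup>2
    \<le> (4 * real CARD('p) + 1) * exp (- r * t)"
proof -
  let ?P = "{1..N} \<times> {1..N}"
  let ?F = "\<lambda>S i t. lohe_field N \<kappa> a \<Xi> (\<lambda>k. S k t) i :: real ^ 'p ^ 'n"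
  let ?G = "\<lambda>S i j t. transpose (?F S i t) ** S j t + transpose (S i t) ** ?F S j t :: real ^ 'p ^ 'p"
  define E where "E = (\<lambda>i j t. transpose (S i t) ** S j t - transpose (T i t) ** T j t)"
  define f where "f = (\<lambda>(i, j) t. E i j t \<bullet> E i j t)"
  define f' where "f' = (\<lambda>(i, j) t. 2 * (E i j t \<bullet> (?G S i j t - ?G T i j t)))"
  \<comment> \<open>the Gram matrices have norm at most \<open>\<surd>p\<close>, so their squared distance starts below \<open>4 p + 1\<close>\<close>
  define h where "h = (\<lambda>t. (4 * real CARD('p) + 1) * exp (- r * t))"
  define h' where "h' = (\<lambda>t. - r * h t)"
  have St: "S i t \<in> stiefel" "T i t \<in> stiefel" if "i \<in> {1..N}" "0 \<le> t" for i t
    using sol that by (auto simp: global_solution_def)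
  have hpos: "0 < h t" for t
    by (simp add: h_def add_nonneg_pos)
  have "f (i, j) t < h t"
  proof (rule finite_family_below_barrier[where P = ?P and f = f and h = h and f' = f' and h' = h'])
    fix p assume "p \<in> ?P"
    then obtain i j where ij: "p = (i, j)" "i \<in> {1..N}" "j \<in> {1..N}"
      by auto
    have "norm (transpose (S i 0) ** S j 0) \<le> sqrt (real CARD('p))"
      using norm_transpose_stiefel_mult_le[OF St(1)[OF ij(2)]] norm_stiefel[OF St(1)[OF ij(3)]]
      by (metis order_refl)
    moreover have "norm (transpose (T i 0) ** T j 0) \<le> sqrt (real CARD('p))"
      using norm_transpose_stiefel_mult_le[OF St(2)[OF ij(2)]] norm_stiefel[OF St(2)[OF ij(3)]]
      by (metis order_refl)
    ultimately have "norm (E i j 0) \<le> 2 * sqrt (real CARD('p))"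
      using norm_triangle_ineq4[of "transpose (S i 0) ** S j 0" "transpose (T i 0) ** T j 0"]
      by (simp add: E_def)
    then have "(norm (E i j 0))\<^sup>2 \<le> (2 * sqrt (real CARD('p)))\<^sup>2"
      by (intro power_mono) auto
    then show "f p 0 < h 0"
      by (simp add: f_def h_def ij power2_norm_eq_inner power_mult_distrib)
  next
    fix p and t :: real assume "p \<in> ?P" "0 \<le> t"
    then obtain i j where ij: "p = (i, j)" "i \<in> {1..N}" "j \<in> {1..N}"
      by auto
    have d: "(S k has_vector_derivative ?F S k t) (at t within {0..})"
      "(T k has_vector_derivative ?F T k t) (at t within {0..})" if "k \<in> {1..N}" for k
      using sol that \<open>0 \<le> t\<close> by (auto simp: global_solution_def)
    have g: "((\<lambda>t. transpose (R i t) ** R j t) has_vector_derivative ?G R i j t) (at t within {0..})"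
      if "(R i has_vector_derivative ?F R i t) (at t within {0..})"
         "(R j has_vector_derivative ?F R j t) (at t within {0..})" for R
      using bounded_bilinear.has_vector_derivative[OF bounded_bilinear_matrix_mult
          bounded_linear.has_vector_derivative[OF bounded_linear_transpose that(1)] that(2)]
      by (simp add: add.commute)
    have "(E i j has_vector_derivative ?G S i j t - ?G T i j t) (at t within {0..})"
      unfolding E_def by (intro has_vector_derivative_diff g d ij)
    from bounded_bilinear.has_vector_derivative[OF bounded_bilinear_inner this this]
    show "(f p has_real_derivative f' p t) (at t within {0..})"
      by (simp add: f_def f'_def ij has_real_derivative_iff_has_vector_derivative inner_commute)
  next
    fix t :: real assume "0 \<le> t"
    show "(h has_real_derivative h' t) (at t within {0..})"
      unfolding h_def h'_def by (auto intro!: derivative_eq_intros)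
  next
    fix p and t :: real
    assume p: "p \<in> ?P" and "0 < t" and touch: "f p t = h t" and le: "\<And>q. q \<in> ?P \<Longrightarrow> f q t \<le> h t"
    obtain i j where ij: "p = (i, j)" "i \<in> {1..N}" "j \<in> {1..N}"
      using p by auto
    have "0 \<le> t"
      using \<open>0 < t\<close> by simp
    have fE: "f (k, l) t = (norm (E k l t))\<^sup>2" for k l
      by (simp add: f_def power2_norm_eq_inner)
    have max: "norm (E k l t) \<le> norm (E i j t)" if "k \<in> {1..N}" "l \<in> {1..N}" for k l
    proof (rule power2_le_imp_le)
      show "(norm (E k l t))\<^sup>2 \<le> (norm (E i j t))\<^sup>2"
        using le[of "(k, l)"] touch that by (simp add: fE ij)
    qed simp
    have "E i j t \<bullet> (?G S i j t - ?G T i j t)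
        \<le> - 2 * \<kappa> * (m - (real N - 1) / real N * (M + \<delta>) - M * (D + D\<^sup>2 / 2)) * (norm (E i j t))\<^sup>2"
      by (rule gram_distance_rate[where E = "\<lambda>k l. E k l t" and S = "\<lambda>k. S k t" and T = "\<lambda>k. T k t"])
        (use St \<open>0 \<le> t\<close> ij skew \<open>0 \<le> \<kappa>\<close> \<open>0 \<le> m\<close> a D max in \<open>auto simp: E_def\<close>)
    also have "\<dots> = - r * h t"
      using touch by (simp add: r fE ij)
    finally have "f' p t \<le> 2 * (- r * h t)"
      by (simp add: f'_def ij)
    moreover have "0 < r * h t"
      using \<open>0 < r\<close> hpos by simp
    ultimately show "f' p t < h' t"
      by (simp add: h'_def)
  qed (use i j \<open>0 \<le> t\<close> in auto)
  then show ?thesis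
    by (simp add: f_def E_def h_def power2_norm_eq_inner)
qed

text \<open>
  The bound is uniform in the shift \<open>s\<close>, so \<open>f\<close> is Cauchy at infinity.
\<close>

lemma convergent_at_top_if_shift_bound:
  fixes f :: "real \<Rightarrow> 'a :: banach"
  assumes g: "(g \<longlongrightarrow> 0) at_top"
    and bound: "\<And>t s. u \<le> t \<Longrightarrow> 0 \<le> s \<Longrightarrow> norm (f t - f (t + s)) \<le> g t"
  shows "\<exists>L. (f \<longlongrightarrow> L) at_top"
proof -
  have "Cauchy (\<lambda>n. f (real n))"
  proof (rule metric_CauchyI)
    fix e :: real assume "0 < e"
    then have "eventually (\<lambda>t. g t < e) at_top"
      using g by (intro order_tendstoD) auto
    then obtain t1 where t1: "\<And>t. t1 \<le> t \<Longrightarrow> g t < e"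
      by (auto simp: eventually_at_top_linorder)
    obtain n0 where n0: "max u t1 \<le> real n0"
      using real_arch_simple by blast
    have *: "dist (f (real n)) (f (real n')) < e" if "n0 \<le> n" "n \<le> n'" for n n'
      using bound[of "real n" "real n' - real n"] t1[of "real n"] n0 that
      by (simp add: dist_norm)
    show "\<exists>M. \<forall>m\<ge>M. \<forall>n\<ge>M. dist (f (real m)) (f (real n)) < e"
      by (intro exI[of _ n0]) (metis * dist_commute nat_le_linear)
  qed
  then obtain L where L: "(\<lambda>n. f (real n)) \<longlonglongrightarrow> L"
    using Cauchy_convergent convergentD by blast
  have "norm (f t - L) \<le> g t" if "u \<le> t" for t
  proof (rule tendsto_upperbound)
    show "(\<lambda>n. norm (f t - f (real n))) \<longlonglongrightarrow> norm (f t - L)"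
      by (intro tendsto_intros L)
    obtain n0 where "t \<le> real n0"
      using real_arch_simple by blast
    then have "norm (f t - f (real n)) \<le> g t" if "n0 \<le> n" for n
      using bound[OF \<open>u \<le> t\<close>, of "real n - t"] that
      by (metis add.commute diff_add_cancel diff_ge_0_iff_ge of_nat_le_iff order_trans)
    then show "eventually (\<lambda>n. norm (f t - f (real n)) \<le> g t) sequentially"
      by (auto simp: eventually_sequentially)
  qed simp
  then have "eventually (\<lambda>t. norm (f t - L) \<le> g t) at_top"
    by (auto simp: eventually_at_top_linorder)
  then have "((\<lambda>t. f t - L) \<longlongrightarrow> 0) at_top"
    using g by (rule Lim_null_comparison)
  then show ?thesis
    using LIM_zero_cancel by blast
qed

section \<open>Parameters\<close>

lemma norm_le_Xi_norm: "i \<in> {1..N} \<Longrightarrow> norm (\<Xi> i) \<le> Xi_norm N \<Xi>"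
  unfolding Xi_norm_def by (intro Max_ge) auto

lemma a_min_le: "i \<in> {1..N} \<Longrightarrow> k \<in> {1..N} \<Longrightarrow> a_min N a \<le> a i k"
  unfolding a_min_def by (rule Min_le) (auto intro!: image_eqI[where x = "(i, k)"])

lemma le_a_max: "i \<in> {1..N} \<Longrightarrow> k \<in> {1..N} \<Longrightarrow> a i k \<le> a_max N a"
  unfolding a_max_def by (rule Max_ge) (auto intro!: image_eqI[where x = "(i, k)"])

lemma le_a_diam:
  "i \<in> {1..N} \<Longrightarrow> j \<in> {1..N} \<Longrightarrow> k \<in> {1..N} \<Longrightarrow> \<bar>a i k - a j k\<bar> \<le> a_diam N a"
  unfolding a_diam_def by (rule Max_ge) (auto intro!: image_eqI[where x = "(i, j, k)"])

lemma a_min_pos: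
  assumes "1 \<le> N" "\<And>i k. i \<in> {1..N} \<Longrightarrow> k \<in> {1..N} \<Longrightarrow> 0 < a i k"
  shows "0 < a_min N a"
proof -
  have "a_min N a \<in> (\<lambda>(i, k). a i k) ` ({1..N} \<times> {1..N})"
    unfolding a_min_def using assms(1) by (intro Min_in) auto
  then show ?thesis
    using assms(2) by auto
qed

text \<open>
  A skew-symmetric \<open>1 \<times> 1\<close> matrix vanishes.
\<close>

lemma two_le_CARD_if_Xi_norm_pos:
  fixes \<Xi> :: "nat \<Rightarrow> real ^ 'p ^ 'p"
  assumes "1 \<le> N" "\<And>i. i \<in> {1..N} \<Longrightarrow> skew_symmetric (\<Xi> i)" "0 < Xi_norm N \<Xi>"
  shows "2 \<le> CARD('p)"
proof (rule ccontr)
  assume "\<not> 2 \<le> CARD('p)"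
  then have "CARD('p) = 1"
    using zero_less_card_finite[where 'a = 'p] by linarith
  then obtain c :: 'p where c: "UNIV = {c}"
    using card_1_singletonE by blast
  have "Xi_norm N \<Xi> \<in> (\<lambda>i. norm (\<Xi> i)) ` {1..N}"
    unfolding Xi_norm_def using assms(1) by (intro Max_in) auto
  then obtain i where i: "i \<in> {1..N}" "Xi_norm N \<Xi> = norm (\<Xi> i)"
    by auto
  have "transpose (\<Xi> i) $ c $ c = - \<Xi> i $ c $ c"
    using assms(2)[OF i(1)] by (simp add: skew_symmetric_def)
  then have "\<Xi> i $ c $ c = 0"
    by (simp add: transpose_def)
  then have "\<Xi> i = 0"
    using c by (metis (full_types) UNIV_I singletonD vec_eq_iff zero_index)
  then show False
    using assms(3) i by simp
qed

text \<open>
  Substituting \<open>a\<^sub>m \<le> a\<^sub>M\<close> into the definition leaves \<open>N \<Lambda> \<le> a\<^sub>M - (N - 1) d(A)\<close>.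
\<close>

lemma Lam_le:
  assumes "2 \<le> N" and "0 < a_min N a"
  shows "real N * Lam N a \<le> a_max N a" "Lam N a \<le> a_max N a" "0 < a_max N a"
proof -
  have one: "1 \<in> {1..N}"
    using assms by auto
  have m: "a_min N a \<le> a_max N a"
    using a_min_le[OF one one, of a] le_a_max[OF one one, of a] by linarith
  then show "0 < a_max N a"
    using assms(2) by linarith
  have "0 \<le> a_diam N a"
    using le_a_diam[OF one one one, of a] by simp
  then have d: "0 \<le> (real N - 1) * a_diam N a"
    using assms(1) by simp
  have "real N * Lam N a = real N * a_min N a - (real N - 1) * (a_max N a + a_diam N a)"
    using assms(1) by (simp add: Lam_def field_simps)
  also have "\<dots> \<le> a_max N a"
    using mult_left_mono[OF m, of "real N"] d by (simp add: algebra_simps)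
  finally show N: "real N * Lam N a \<le> a_max N a" .
  show "Lam N a \<le> a_max N a"
  proof (cases "0 \<le> Lam N a")
    case True
    then have "1 * Lam N a \<le> real N * Lam N a"
      using assms(1) by (intro mult_right_mono) auto
    then show ?thesis
      using N by linarith
  qed (use \<open>0 < a_max N a\<close> in linarith)
qed

text \<open>
  The denominator is positive since \<open>\<Lambda> \<le> a\<^sub>M\<close>, and discarding \<open>\<Lambda>\<^sup>3\<close> makes it larger.
\<close>

lemma kappa_star_ge:
  fixes \<Xi> :: "nat \<Rightarrow> real ^ 'p ^ 'p"
  assumes "0 < Lam N a" "Lam N a \<le> a_max N a" "0 < a_min N a" "0 < Xi_norm N \<Xi>"
  shows "2 * real CARD('p) * a_max N a * Xi_norm N \<Xi> / (a_min N a * Lam N a) \<le> kappa_star N a \<Xi>"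
    and "0 < kappa_star N a \<Xi>"
proof -
  define p m M l x where "p = real CARD('p)" and "m = a_min N a" and "M = a_max N a"
    and "l = Lam N a" and "x = Xi_norm N \<Xi>"
  have pos: "0 < l" "l \<le> M" "0 < m" "0 < x" "1 \<le> p" "0 < M"
    using assms zero_less_card_finite[where 'a = 'p] by (auto simp: p_def m_def M_def l_def x_def Suc_le_eq)
  have "l\<^sup>2 \<le> M\<^sup>2"
    using pos by (intro power_mono) auto
  moreover have "M\<^sup>2 < 8 * p * M\<^sup>2"
    using pos by simp
  ultimately have "0 < 8 * p * M\<^sup>2 - l\<^sup>2"
    by linarith
  then have "0 < l * (8 * p * M\<^sup>2 - l\<^sup>2)"
    using pos by simp
  then have den: "0 < 8 * p * M\<^sup>2 * l - l ^ 3"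
    by (simp add: power2_eq_square power3_eq_cube algebra_simps)
  have num: "0 < 16 * p\<^sup>2 * M ^ 3 * x"
    using pos by simp
  have ks: "kappa_star N a \<Xi> = 16 * p\<^sup>2 * M ^ 3 * x / (m * (8 * p * M\<^sup>2 * l - l ^ 3))"
    by (simp add: kappa_star_def p_def m_def M_def l_def x_def)
  show "0 < kappa_star N a \<Xi>"
    unfolding ks using num den pos by simp
  have "2 * p * M * x / (m * l) = 16 * p\<^sup>2 * M ^ 3 * x / (m * (8 * p * M\<^sup>2 * l))"
    using pos by (simp add: field_simps power2_eq_square power3_eq_cube)
  also have "\<dots> \<le> kappa_star N a \<Xi>"
    unfolding ks using num den pos by (intro divide_left_mono mult_left_mono) auto
  finally show "2 * real CARD('p) * a_max N a * Xi_norm N \<Xi> / (a_min N a * Lam N a) \<le> kappa_star N a \<Xi>"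
    by (simp add: p_def m_def M_def l_def x_def)
qed

section \<open>Phase locking\<close>

theorem theorem1p2:
  fixes N :: nat and \<kappa> \<alpha> \<beta> :: real
    and a :: "nat \<Rightarrow> nat \<Rightarrow> real"
    and \<Xi> :: "nat \<Rightarrow> real ^ 'p ^ 'p"
    and Sin :: "nat \<Rightarrow> real ^ 'p ^ 'n"
    and S :: "nat \<Rightarrow> real \<Rightarrow> real ^ 'p ^ 'n"
  assumes "CARD('p) \<le> CARD('n)" and "N \<ge> 1"
    and "\<And>i. i \<in> {1..N} \<Longrightarrow> skew_symmetric (\<Xi> i)"
    and "Xi_norm N \<Xi> > 0" and "\<kappa> > 0"
    and "\<And>i k. i \<in> {1..N} \<Longrightarrow> k \<in> {1..N} \<Longrightarrow> a i k = a k i \<and> a i k > 0"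
    and "0 < Lam N a" and "Lam N a < 8 * real CARD('p) * (a_max N a)\<^sup>2"
    and "\<alpha> < \<beta>"
    and "{r. r > 0 \<and> r ^ 3 - 2 * r +
           2 * sqrt (real CARD('p)) * Xi_norm N \<Xi> / (kappa_star N a \<Xi> * a_min N a) = 0} = {\<alpha>, \<beta>}"
    and "\<And>i. i \<in> {1..N} \<Longrightarrow> Sin i \<in> stiefel"
    and "global_solution N \<kappa> a \<Xi> Sin S"
    and "\<kappa> > max (sqrt (6 * real CARD('p)) / 9 * (Xi_norm N \<Xi> / a_min N a)) (kappa_star N a \<Xi>)"
    and "(MAX (i, j)\<in>{1..N} \<times> {1..N}. norm (Sin i - Sin j)) < \<beta>"
  shows "phase_locks N S"
  unfolding phase_locks_def
proof (intro ballI)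
  fix i j assume i: "i \<in> {1..N}" and j: "j \<in> {1..N}"
  note sol = \<open>global_solution N \<kappa> a \<Xi> Sin S\<close>
  show "\<exists>L. ((\<lambda>t. transpose (S i t) ** S j t) \<longlongrightarrow> L) at_top"
  proof (cases "N = 1")
    case True
    then have "i = j"
      using i j by simp
    have "eventually (\<lambda>t. transpose (S i t) ** S j t = mat 1) at_top"
      unfolding eventually_at_top_linorder
      by (intro exI[of _ 0]) (use sol i \<open>i = j\<close> in \<open>auto simp: global_solution_def stiefel_def\<close>)
    then show ?thesis
      by (intro exI[of _ "mat 1"]) (rule tendsto_eventually)
  next
    case False
    then have "2 \<le> N"
      using \<open>N \<ge> 1\<close> by simp
    define m M \<delta> l x where "m = a_min N a" and "M = a_max N a" and "\<delta> = a_diam N a"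
      and "l = Lam N a / a_max N a" and "x = Xi_norm N \<Xi>"
    have "0 < m"
      unfolding m_def using assms(2,6) by (intro a_min_pos) auto
    note Lam = Lam_le[OF \<open>2 \<le> N\<close> \<open>0 < m\<close>[unfolded m_def]]
    note ks = kappa_star_ge[OF \<open>0 < Lam N a\<close> Lam(2) \<open>0 < m\<close>[unfolded m_def] \<open>Xi_norm N \<Xi> > 0\<close>]
    have "0 < M"
      using Lam(3) by (simp add: M_def)
    have l: "0 < l" "l \<le> 1 / real N" "Lam N a = M * l"
      using Lam(1,3) \<open>0 < Lam N a\<close> \<open>2 \<le> N\<close> by (auto simp: l_def M_def field_simps)
    have "1 / real N \<le> 1 / 2"
      using \<open>2 \<le> N\<close> by (simp add: field_simps)
    then have "l \<le> 1 / 2"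
      using l(2) by linarith
    have "0 < x"
      using \<open>Xi_norm N \<Xi> > 0\<close> by (simp add: x_def)

    \<comment> \<open>the constant term of the cubic is positive, which puts its roots below \<open>\<surd>2\<close>\<close>
    have "\<beta> \<in> {\<alpha>, \<beta>}"
      by simp
    then have \<beta>: "0 < \<beta>" "\<beta> ^ 3 - 2 * \<beta> + 2 * sqrt (real CARD('p)) * x / (kappa_star N a \<Xi> * m) = 0"
      unfolding \<open>_ = {\<alpha>, \<beta>}\<close>[symmetric] by (auto simp: x_def m_def)
    have "0 < 2 * sqrt (real CARD('p)) * x / (kappa_star N a \<Xi> * m)"
      using \<open>0 < x\<close> \<open>0 < m\<close> ks(2) zero_less_card_finite[where 'a = 'p] by simp
    then have "\<beta> * (\<beta>\<^sup>2 - 2) < 0"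
      using \<beta>(2) by (simp add: power2_eq_square power3_eq_cube algebra_simps)
    then have "\<beta>\<^sup>2 < 2"
      using \<beta>(1) by (simp add: mult_less_0_iff)
    have init: "(norm (Sin k - Sin n))\<^sup>2 < 2" if "k \<in> {1..N}" "n \<in> {1..N}" for k n
    proof -
      have "norm (Sin k - Sin n) \<le> (MAX (i, j)\<in>{1..N} \<times> {1..N}. norm (Sin i - Sin j))"
        by (rule Max_ge) (use that in \<open>auto intro!: image_eqI[where x = "(k, n)"]\<close>)
      then have "(norm (Sin k - Sin n))\<^sup>2 \<le> \<beta>\<^sup>2"
        using assms(14) by (intro power_mono) auto
      then show ?thesis
        using \<open>\<beta>\<^sup>2 < 2\<close> by linarith
    qed

    \<comment> \<open>the bound \<open>p \<ge> 2\<close> turns \<open>\<kappa> > \<kappa>\<^sub>*\<close> into a margin of the attraction over the rotations\<close>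
    have "2 \<le> real CARD('p)"
      using two_le_CARD_if_Xi_norm_pos[OF assms(2,3,4)] by simp
    then have "2 * 2 * M * x / (m * (M * l)) \<le> 2 * real CARD('p) * M * x / (m * (M * l))"
      using \<open>0 < x\<close> \<open>0 < m\<close> \<open>0 < M\<close> l(1) by (intro divide_right_mono mult_right_mono mult_left_mono) auto
    also have "\<dots> < \<kappa>"
      using ks(1) assms(13) l(3) by (simp add: m_def M_def x_def)
    finally have \<kappa>: "2 * x < \<kappa> * m * (l / 2)"
      using \<open>0 < m\<close> \<open>0 < M\<close> l(1) by (simp add: field_simps)
    have gap: "\<kappa> * m * (l / 2) - 2 * x \<le> \<kappa> * m * (d - (real N - 1) / real N * (d ^ 3 / 2)) - 2 * x"
      if "3 / 4 * l \<le> d" "d\<^sup>2 \<le> 2" for d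
      using cubic_gap[of "real N" l d] that l \<open>2 \<le> N\<close> \<open>\<kappa> > 0\<close> \<open>0 < m\<close>
      by (intro diff_right_mono mult_left_mono) auto
    have "(3 / 4 * l)\<^sup>2 \<le> 1\<^sup>2"
      using l(1) \<open>l \<le> 1 / 2\<close> by (intro power_mono) auto
    then have "(3 / 4 * l)\<^sup>2 \<le> 2"
      by simp
    obtain t0 where t0: "0 \<le> t0"
      "\<And>t k n. t0 \<le> t \<Longrightarrow> k \<in> {1..N} \<Longrightarrow> n \<in> {1..N} \<Longrightarrow> norm (S k t - S n t) \<le> 4 / 5 * l"
    proof (rule spread_eventually_le[OF sol assms(3), where x = x and m = m and \<mu> = "3 / 4 * l"
          and \<nu> = "4 / 5 * l" and \<epsilon> = "\<kappa> * m * (l / 2) - 2 * x"])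
      show "norm (\<Xi> k) \<le> x" "m \<le> a k n" if "k \<in> {1..N}" "n \<in> {1..N}" for k n
        using that norm_le_Xi_norm a_min_le by (auto simp: x_def m_def)
    qed (use init gap \<kappa> l(1) \<open>(3 / 4 * l)\<^sup>2 \<le> 2\<close> \<open>\<kappa> > 0\<close> \<open>0 < m\<close> in auto)

    \<comment> \<open>with \<open>l \<le> 1 / 2\<close> this spread is below the threshold \<open>D + D\<^sup>2 / 2 < l\<close> of contraction\<close>
    define D where "D = 4 / 5 * l"
    define r where "r = 2 * \<kappa> * (m - (real N - 1) / real N * (M + \<delta>) - M * (D + D\<^sup>2 / 2))"
    have "m - (real N - 1) / real N * (M + \<delta>) - M * (D + D\<^sup>2 / 2) = M * (l * (1 / 5 - 8 / 25 * l))"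
      using l(3) by (simp add: Lam_def m_def M_def \<delta>_def D_def power2_eq_square algebra_simps)
    moreover have "0 < 1 / 5 - 8 / 25 * l"
      using \<open>l \<le> 1 / 2\<close> by simp
    ultimately have "0 < r"
      unfolding r_def using \<open>\<kappa> > 0\<close> \<open>0 < M\<close> l(1) by simp
    let ?C = "4 * real CARD('p) + 1"
    show ?thesis
    proof (rule convergent_at_top_if_shift_bound[where u = t0])
      note exp_decay_tendsto_0[OF \<open>0 < r\<close>, of t0]
      then have "((\<lambda>t. sqrt (?C * exp (- r * (t - t0)))) \<longlongrightarrow> sqrt (?C * 0)) at_top"
        by (intro tendsto_intros)
      then show "((\<lambda>t. sqrt (?C * exp (- r * (t - t0)))) \<longlongrightarrow> 0) at_top"
        by simp
    next
      fix t s :: real assume "t0 \<le> t" "0 \<le> s"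
      have "(norm (transpose (S i (t - t0 + t0)) ** S j (t - t0 + t0)
          - transpose (S i (t - t0 + (t0 + s))) ** S j (t - t0 + (t0 + s))))\<^sup>2 \<le> ?C * exp (- r * (t - t0))"
      proof (rule gram_difference_decay[where S = "\<lambda>i t. S i (t + t0)" and T = "\<lambda>i t. S i (t + (t0 + s))"])
        show "global_solution N \<kappa> a \<Xi> (\<lambda>i. S i t0) (\<lambda>i t. S i (t + t0))"
          using sol t0(1) by (rule global_solution_shift)
        show "global_solution N \<kappa> a \<Xi> (\<lambda>i. S i (t0 + s)) (\<lambda>i t. S i (t + (t0 + s)))"
          using sol t0(1) \<open>0 \<le> s\<close> by (intro global_solution_shift) auto
      qed (use assms(3) \<open>\<kappa> > 0\<close> \<open>0 < m\<close> a_min_le le_a_max le_a_diam t0 r_def \<open>0 < r\<close> i j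
          \<open>t0 \<le> t\<close> \<open>0 \<le> s\<close> in \<open>auto simp: m_def M_def \<delta>_def D_def\<close>)
      then show "norm (transpose (S i t) ** S j t - transpose (S i (t + s)) ** S j (t + s))
          \<le> sqrt (?C * exp (- r * (t - t0)))"
        by (intro real_le_rsqrt) (simp add: add_ac)
    qed
  qed
qed

end
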